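(* Let $(Y,\ast)$ be a $2$-dimensional systolic complex with a basepoint $\ast\in Y^0$ and let $(X_Y,\ast)$ be the squaring of $(Y,\ast)$. Then $Y^1$ is quasi-isometric to $X_Y^1$ (each with the shortest path metric on its vertex set).
   Context: All graphs are simplicial. Metrics are considered only on the $0$-skeleton of a complex, and are induced by the shortest path metric $d$ of the $1$-skeleton. The girth of a graph is the length of a shortest embedded cycle (infinite if there is none). The link of a vertex $v$ in a $2$-dimensional simplicial complex is the graph whose vertices are the neighbours of $v$, two of them being joined by an edge if they span a triangle together with $v$. A $2$-dimensional systolic complex is a simply connected $2$-dimensional simplicial complex in which the girth of the link of every vertex is at least $6$. Squaring: given a $2$-dimensional systolic complex $Y$ with basepoint $\ast\in Y^0$, let $X_Y^1$ be the subgraph of $Y^1$ with vertex set $Y^0$ whose edges are all the edges of $Y^1$ whose endpoints are not equidistant to $\ast$ (distances in $Y^1$). The squaring of $(Y,\ast)$ is the based square complex $(X_Y,\ast)$ obtained from $X_Y^1$ by attaching a unique square ($2$-cell) along its boundary to each embedded $4$-cycle of $X_Y^1$. *)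

theory Defs
  imports "HOL-Analysis.Analysis" "HOL-Library.Extended_Nat"
begin

section \<open>Graphs\<close>

text \<open>Edges are two-element sets of vertices, so a graph in the sense of \<open>simplicial_graph\<close>
  has neither loops nor multiple edges.\<close>

record 'v ugraph =
  verts :: "'v set"
  edges :: "'v set set"

definition simplicial_graph :: "'v ugraph \<Rightarrow> bool" where
  "simplicial_graph G \<longleftrightarrow> (\<forall>e\<in>edges G. e \<subseteq> verts G \<and> card e = 2)"

definition is_walk :: "'v ugraph \<Rightarrow> 'v list \<Rightarrow> bool" where
  "is_walk G p \<longleftrightarrow> p \<noteq> [] \<and> set p \<subseteq> verts G \<and>
     (\<forall>i. Suc i < length p \<longrightarrow> {p ! i, p ! Suc i} \<in> edges G)"

text \<open>If no walk joins the two vertices, the value is the junk value \<open>Inf {} = 0\<close>; thus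
  \<open>path_metric G\<close> is a metric on \<open>verts G\<close> exactly when \<open>G\<close> is connected.\<close>

definition path_metric :: "'v ugraph \<Rightarrow> 'v \<Rightarrow> 'v \<Rightarrow> real" where
  "path_metric G u v =
     real (Inf {length p - 1 | p. is_walk G p \<and> hd p = u \<and> last p = v})"

text \<open>The closing edge from the last vertex of the list back to the first one is included
  through the index modulo the length.\<close>

definition cycle_edges :: "'v list \<Rightarrow> 'v set set" where
  "cycle_edges c = {{c ! i, c ! (Suc i mod length c)} | i. i < length c}"

definition embedded_cycle :: "'v ugraph \<Rightarrow> 'v list \<Rightarrow> bool" where
  "embedded_cycle G c \<longleftrightarrow>
     3 \<le> length c \<and> distinct c \<and> set c \<subseteq> verts G \<and> cycle_edges c \<subseteq> edges G"

definition girth :: "'v ugraph \<Rightarrow> enat" where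
  "girth G = Inf {enat (length c) | c. embedded_cycle G c}"


section \<open>Simplicial complexes and their geometric realization\<close>

definition abstract_simplicial_complex :: "'v set set \<Rightarrow> bool" where
  "abstract_simplicial_complex K \<longleftrightarrow>
     (\<forall>s\<in>K. finite s \<and> s \<noteq> {} \<and> (\<forall>t. t \<subseteq> s \<and> t \<noteq> {} \<longrightarrow> t \<in> K))"

definition one_skeleton :: "'v set set \<Rightarrow> 'v ugraph" where
  "one_skeleton K = \<lparr>verts = {v. {v} \<in> K}, edges = {e \<in> K. card e = 2}\<rparr>"

definition vertex_link :: "'v set set \<Rightarrow> 'v \<Rightarrow> 'v ugraph" where
  "vertex_link K v =
     \<lparr>verts = {w. w \<noteq> v \<and> {v, w} \<in> K},
      edges = {e. card e = 2 \<and> v \<notin> e \<and> insert v e \<in> K}\<rparr>"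

text \<open>Points of the realization are given by barycentric coordinates.\<close>

definition realized_simplex :: "'v set \<Rightarrow> ('v \<Rightarrow> real) set" where
  "realized_simplex s = {x. (\<forall>v. 0 \<le> x v) \<and> (\<forall>v. v \<notin> s \<longrightarrow> x v = 0) \<and> sum x s = 1}"

text \<open>The weak topology: a set is open if its trace on every closed simplex is open. The
  topology of pointwise convergence of \<open>'v \<Rightarrow> real\<close>, used here for a single simplex, is the
  Euclidean topology of that simplex, because simplices are finite.\<close>

definition geometric_realization :: "'v set set \<Rightarrow> ('v \<Rightarrow> real) topology" where
  "geometric_realization K = topology (\<lambda>U.
     U \<subseteq> (\<Union>s\<in>K. realized_simplex s) \<and>
     (\<forall>s\<in>K. openin (top_of_set (realized_simplex s)) (U \<inter> realized_simplex s)))"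

lemma openin_geometric_realization:
  "openin (geometric_realization K) U \<longleftrightarrow>
     U \<subseteq> (\<Union>s\<in>K. realized_simplex s) \<and>
     (\<forall>s\<in>K. openin (top_of_set (realized_simplex s)) (U \<inter> realized_simplex s))"
proof -
  let ?P = "\<lambda>U. U \<subseteq> (\<Union>s\<in>K. realized_simplex s) \<and>
     (\<forall>s\<in>K. openin (top_of_set (realized_simplex s)) (U \<inter> realized_simplex s))"
  have "istopology ?P"
    unfolding istopology_def
  proof (intro conjI allI impI)
    fix S T assume S: "?P S" and T: "?P T"
    show "S \<inter> T \<subseteq> (\<Union>s\<in>K. realized_simplex s)" using S by blast
    show "\<forall>s\<in>K. openin (top_of_set (realized_simplex s)) (S \<inter> T \<inter> realized_simplex s)"
    proof
      fix s assume "s \<in> K"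
      then have "openin (top_of_set (realized_simplex s))
          ((S \<inter> realized_simplex s) \<inter> (T \<inter> realized_simplex s))"
        using S T by (metis openin_Int)
      moreover have "(S \<inter> realized_simplex s) \<inter> (T \<inter> realized_simplex s)
          = S \<inter> T \<inter> realized_simplex s" by blast
      ultimately show "openin (top_of_set (realized_simplex s)) (S \<inter> T \<inter> realized_simplex s)"
        by simp
    qed
  next
    fix \<U> assume U: "\<forall>S\<in>\<U>. ?P S"
    then show "\<Union>\<U> \<subseteq> (\<Union>s\<in>K. realized_simplex s)" by blast
    show "\<forall>s\<in>K. openin (top_of_set (realized_simplex s)) (\<Union>\<U> \<inter> realized_simplex s)"
    proof
      fix s assume "s \<in> K"
      then have "openin (top_of_set (realized_simplex s)) (\<Union>S\<in>\<U>. S \<inter> realized_simplex s)"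
        using U by (intro openin_Union ballI) (elim imageE, simp)
      then show "openin (top_of_set (realized_simplex s)) (\<Union>\<U> \<inter> realized_simplex s)"
        by (simp only: Int_Union2)
    qed
  qed
  then show ?thesis
    unfolding geometric_realization_def by (simp add: topology_inverse')
qed

lemma topspace_geometric_realization:
  "topspace (geometric_realization K) = (\<Union>s\<in>K. realized_simplex s)"
proof
  show "topspace (geometric_realization K) \<subseteq> (\<Union>s\<in>K. realized_simplex s)"
    using openin_topspace[of "geometric_realization K"]
    unfolding openin_geometric_realization by blast
  have "openin (geometric_realization K) (\<Union>s\<in>K. realized_simplex s)"
    unfolding openin_geometric_realization
  proof (intro conjI ballI)
    fix s assume "s \<in> K"
    then have "(\<Union>s\<in>K. realized_simplex s) \<inter> realized_simplex s = realized_simplex s" by blast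
    then show "openin (top_of_set (realized_simplex s))
        ((\<Union>s\<in>K. realized_simplex s) \<inter> realized_simplex s)" by simp
  qed simp
  then show "(\<Union>s\<in>K. realized_simplex s) \<subseteq> topspace (geometric_realization K)"
    by (rule openin_subset)
qed

text \<open>Path-connected with trivial fundamental group: every loop is homotopic, relative to its
  base point, to the constant loop. (The library's \<open>simply_connected\<close> covers only subsets of
  type-class topological spaces, whose topology is inherited from the type.)\<close>

definition simply_connected_space :: "'a topology \<Rightarrow> bool" where
  "simply_connected_space X \<longleftrightarrow>
     path_connected_space X \<and>
     (\<forall>p. pathin X p \<and> p 0 = p 1 \<longrightarrow>
        homotopic_with (\<lambda>r. r 0 = p 0 \<and> r 1 = p 0) (top_of_set {0..1}) X p (\<lambda>_. p 0))"


section \<open>Two-dimensional systolic complexes and squaring\<close>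

text \<open>``Two-dimensional'' means of dimension at most two, so trees are included.\<close>

definition systolic_2_complex :: "'v set set \<Rightarrow> bool" where
  "systolic_2_complex K \<longleftrightarrow>
     abstract_simplicial_complex K \<and>
     (\<forall>s\<in>K. card s \<le> 3) \<and>
     simply_connected_space (geometric_realization K) \<and>
     (\<forall>v\<in>verts (one_skeleton K). 6 \<le> girth (vertex_link K v))"

text \<open>A square is recorded by its boundary, the set of its four edges. Hence there is exactly
  one square for each embedded 4-cycle, irrespective of starting vertex and orientation of the
  list tracing it out.\<close>

record 'v based_square_complex =
  square_skeleton :: "'v ugraph"
  squares :: "'v set set set"
  basepoint :: 'v

definition squaring_graph :: "'v set set \<Rightarrow> 'v \<Rightarrow> 'v ugraph" where
  "squaring_graph Y b =
     \<lparr>verts = verts (one_skeleton Y),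
      edges = {{u, v} | u v. {u, v} \<in> edges (one_skeleton Y) \<and>
                 path_metric (one_skeleton Y) u b \<noteq> path_metric (one_skeleton Y) v b}\<rparr>"

definition squaring :: "'v set set \<Rightarrow> 'v \<Rightarrow> 'v based_square_complex" where
  "squaring Y b =
     \<lparr>square_skeleton = squaring_graph Y b,
      squares = {cycle_edges c | c. embedded_cycle (squaring_graph Y b) c \<and> length c = 4},
      basepoint = b\<rparr>"

lemma abstract_simplicial_complex_face:
  "abstract_simplicial_complex K \<Longrightarrow> s \<in> K \<Longrightarrow> t \<subseteq> s \<Longrightarrow> t \<noteq> {} \<Longrightarrow> t \<in> K"
  unfolding abstract_simplicial_complex_def by blast

lemma simplicial_graph_one_skeleton:
  assumes "abstract_simplicial_complex K"
  shows "simplicial_graph (one_skeleton K)"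
proof -
  have "{v} \<in> K" if "e \<in> K" "v \<in> e" for e v
    by (rule abstract_simplicial_complex_face[OF assms that(1)]) (use that in simp_all)
  then show ?thesis
    unfolding simplicial_graph_def one_skeleton_def by fastforce
qed

lemma simplicial_graph_vertex_link:
  assumes "abstract_simplicial_complex K"
  shows "simplicial_graph (vertex_link K v)"
proof -
  have "w \<noteq> v \<and> {v, w} \<in> K" if "v \<notin> e" "insert v e \<in> K" "w \<in> e" for e w
  proof
    show "w \<noteq> v" using that by blast
    show "{v, w} \<in> K"
      by (rule abstract_simplicial_complex_face[OF assms that(2)]) (use that in simp_all)
  qed
  then show ?thesis
    unfolding simplicial_graph_def vertex_link_def by fastforce
qed

lemma simplicial_graph_squaring:
  assumes "abstract_simplicial_complex Y"
  shows "simplicial_graph (square_skeleton (squaring Y b))"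
  using simplicial_graph_one_skeleton[OF assms]
  unfolding simplicial_graph_def squaring_def squaring_graph_def by auto


section \<open>Quasi-isometry\<close>

text \<open>Being a relation between metric spaces, it includes that both distance functions are
  metrics; for path metrics this amounts to connectedness of the graphs.\<close>

definition quasi_isometric ::
  "'a set \<Rightarrow> ('a \<Rightarrow> 'a \<Rightarrow> real) \<Rightarrow> 'b set \<Rightarrow> ('b \<Rightarrow> 'b \<Rightarrow> real) \<Rightarrow> bool" where
  "quasi_isometric M d M' d' \<longleftrightarrow>
     Metric_space M d \<and> Metric_space M' d' \<and>
     (\<exists>f L C. f \<in> M \<rightarrow> M' \<and> 1 \<le> L \<and> 0 \<le> C \<and>
        (\<forall>x\<in>M. \<forall>y\<in>M. d x y / L - C \<le> d' (f x) (f y) \<and> d' (f x) (f y) \<le> L * d x y + C) \<and>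
        (\<forall>z\<in>M'. \<exists>x\<in>M. d' z (f x) \<le> C))"

end

theory Submission
  imports Defs "HOL-Library.FSet"
begin

text \<open>The squaring deletes exactly the edges whose endpoints are equidistant to the base point. Such
  an edge lies in a triangle whose third vertex is one step closer to the base point, so it can be
  replaced by a path of two remaining edges, and the two path metrics differ by a factor of at most 2.

  The triangle is found by building the universal cover layer by layer from the base point. In a
  layer every vertex has one predecessor or two adjacent ones, two vertices are adjacent only if they
  share a predecessor, and a new vertex has at most two predecessors because the links contain no
  cycles of length 3, 4 or 5. These facts make the projection to the complex a covering, and simple
  connectivity, applied to a null-homotopy sampled on a fine grid, shows that it is injective.
  Hence the layers are the spheres around the base point, where the triangle is visible.\<close>

section \<open>Edge loops in the geometric realization\<close>

definition vertex_point :: "'v \<Rightarrow> 'v \<Rightarrow> real" where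
  "vertex_point a = (\<lambda>v. if v = a then 1 else 0)"

lemma realized_simplex_support:
  assumes "x \<in> realized_simplex s" shows "{v. 0 < x v} \<subseteq> s" "\<exists>v. 0 < x v"
proof -
  have x: "\<And>v. 0 \<le> x v" "\<And>v. v \<notin> s \<Longrightarrow> x v = 0" "sum x s = 1"
    using assms by (auto simp: realized_simplex_def)
  show "{v. 0 < x v} \<subseteq> s" using x(2) by force
  have "\<exists>v. x v \<noteq> 0" using x(3) by (metis sum.neutral zero_neq_one)
  then show "\<exists>v. 0 < x v" using x(1) by (metis less_eq_real_def)
qed

text \<open>Vertices with positive coordinate at a point lie in every closed simplex containing it,
  so vertices whose open stars share a point span a simplex.\<close>

lemma support_face:
  assumes "abstract_simplicial_complex K" "x \<in> topspace (geometric_realization K)"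
    and "A \<noteq> {}" "\<And>v. v \<in> A \<Longrightarrow> 0 < x v"
  shows "A \<in> K"
proof -
  obtain s where "s \<in> K" "x \<in> realized_simplex s"
    using assms(2) by (auto simp: topspace_geometric_realization)
  then have "A \<subseteq> s" using realized_simplex_support(1) assms(4) by blast
  then show ?thesis using abstract_simplicial_complex_face[OF assms(1) \<open>s \<in> K\<close>] assms(3) by blast
qed

lemma vertex_point_topspace:
  assumes "{a} \<in> K" shows "vertex_point a \<in> topspace (geometric_realization K)"
  unfolding topspace_geometric_realization
  by (rule UN_I[OF assms]) (auto simp: realized_simplex_def vertex_point_def)

lemma openin_open_star:
  "openin (geometric_realization K) {x \<in> topspace (geometric_realization K). 0 < x v}"
  unfolding openin_geometric_realization topspace_geometric_realization
proof (intro conjI ballI)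
  fix s assume s: "s \<in> K"
  have "open {x :: 'a \<Rightarrow> real. 0 < x v}"
    by (intro open_Collect_less continuous_on_const continuous_on_product_coordinates)
  moreover have "{x \<in> \<Union> (realized_simplex ` K). 0 < x v} \<inter> realized_simplex s =
      realized_simplex s \<inter> {x. 0 < x v}" using s by blast
  ultimately show "openin (top_of_set (realized_simplex s))
      ({x \<in> \<Union> (realized_simplex ` K). 0 < x v} \<inter> realized_simplex s)"
    by (metis openin_open_Int)
qed auto

text \<open>A closed simplex includes continuously into the weak topology, so continuity of a map
  into one simplex may be checked coordinatewise.\<close>

lemma continuous_map_into_simplex:
  assumes "s \<in> K" "continuous_on J f" "f ` J \<subseteq> realized_simplex s"
  shows "continuous_map (top_of_set J) (geometric_realization K) f"
proof -
  have "continuous_map (top_of_set J) (top_of_set (realized_simplex s)) f"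
    using assms(2,3) by (auto simp: continuous_map_in_subtopology)
  moreover have "continuous_map (top_of_set (realized_simplex s)) (geometric_realization K) id"
    unfolding continuous_map
  proof (intro conjI allI impI)
    fix U assume "openin (geometric_realization K) U"
    then have "openin (top_of_set (realized_simplex s)) (U \<inter> realized_simplex s)"
      using assms(1) by (simp add: openin_geometric_realization)
    moreover have "{x \<in> topspace (top_of_set (realized_simplex s)). id x \<in> U} =
        U \<inter> realized_simplex s" by auto
    ultimately show "openin (top_of_set (realized_simplex s))
        {x \<in> topspace (top_of_set (realized_simplex s)). id x \<in> U}" by simp
  qed (use assms(1) in \<open>auto simp: topspace_geometric_realization\<close>)
  ultimately have "continuous_map (top_of_set J) (geometric_realization K) (id \<circ> f)"
    by (rule continuous_map_compose)
  then show ?thesis by simp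
qed

section \<open>Polygonal paths through a sequence of vertices\<close>

definition edge_point :: "'v \<Rightarrow> 'v \<Rightarrow> real \<Rightarrow> 'v \<Rightarrow> real" where
  "edge_point a c f = (\<lambda>v. (1 - f) * vertex_point a v + f * vertex_point c v)"

lemma edge_point_simps [simp]: "edge_point a c 0 = vertex_point a" "edge_point a c 1 = vertex_point c"
  by (auto simp: edge_point_def)

lemma edge_point_simplex:
  assumes "0 \<le> f" "f \<le> 1" shows "edge_point a c f \<in> realized_simplex {a, c}"
  using assms by (cases "a = c") (auto simp: realized_simplex_def edge_point_def vertex_point_def)

lemma continuous_on_edge_point:
  assumes "continuous_on J g" shows "continuous_on J (\<lambda>t. edge_point a c (g t))"
  unfolding edge_point_def
  by (intro continuous_on_coordinatewise_then_product continuous_intros assms)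

text \<open>Clamping the index lets the last segment contain its endpoint.\<close>

definition polygon :: "(nat \<Rightarrow> 'v) \<Rightarrow> nat \<Rightarrow> real \<Rightarrow> 'v \<Rightarrow> real" where
  "polygon w m t =
     (let k = min (nat \<lfloor>real m * t\<rfloor>) (m - 1) in edge_point (w k) (w (Suc k)) (real m * t - real k))"

lemma polygon_eq:
  assumes "k < m" "real k \<le> real m * t" "real m * t \<le> real k + 1"
  shows "polygon w m t = edge_point (w k) (w (Suc k)) (real m * t - real k)"
\<comment> \<open>At the right end of segment \<open>k\<close> the rounded index is already
  \<open>Suc k\<close>; it selects the start of the next segment, or is clamped back to
  \<open>k\<close> on the last one.\<close>
proof (cases "real m * t = real k + 1")
  case True
  then have f: "nat \<lfloor>real m * t\<rfloor> = Suc k" by linarith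
  show ?thesis
  proof (cases "Suc k < m")
    case T: True
    then have "min (Suc k) (m - 1) = Suc k" by simp
    then show ?thesis using True f by (simp add: polygon_def Let_def)
  next
    case False
    then have "min (Suc k) (m - 1) = k" using assms(1) by simp
    then show ?thesis using True f by (simp add: polygon_def Let_def)
  qed
next
  case False
  then have "nat \<lfloor>real m * t\<rfloor> = k" using assms by linarith
  then show ?thesis using assms(1) by (simp add: polygon_def Let_def min_absorb1)
qed

lemma polygon_vertex:
  assumes "k \<le> m" "0 < m" shows "polygon w m (real k / real m) = vertex_point (w k)"
proof (cases "k < m")
  case True
  then show ?thesis using polygon_eq[of k m "real k / real m" w] by simp
next
  case False
  then have "k = Suc (m - 1)" "k = m" using assms by simp_all
  then show ?thesis using polygon_eq[of "m - 1" m "real k / real m" w] assms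
    by (simp add: of_nat_diff)
qed

text \<open>The finitely many closed pieces agree where they meet, because \<open>polygon_eq\<close>
  holds up to both ends of a segment.\<close>

lemma pathin_polygon:
  assumes "0 < m" "\<And>k. k < m \<Longrightarrow> {w k, w (Suc k)} \<in> K"
  shows "pathin (geometric_realization K) (polygon w m)"
  unfolding pathin_def
proof (rule pasting_lemma_closed[where I = "{..<m}"
      and T = "\<lambda>k. {real k / real m .. (real k + 1) / real m} \<inter> {0..1}"
      and f = "\<lambda>k t. edge_point (w k) (w (Suc k)) (real m * t - real k)"])
  have mem: "t \<in> {real k / real m .. (real k + 1) / real m} \<longleftrightarrow>
      real k \<le> real m * t \<and> real m * t \<le> real k + 1" for k t
    using assms(1) by (auto simp: field_simps)
  show "closedin (top_of_set {0..1}) ({real k / real m .. (real k + 1) / real m} \<inter> {0..1})" for k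
    by (intro closed_subset) (auto intro: closed_Int)
  show "continuous_map (subtopology (top_of_set {0..1}) ({real k / real m .. (real k + 1) / real m} \<inter> {0..1}))
      (geometric_realization K) (\<lambda>t. edge_point (w k) (w (Suc k)) (real m * t - real k))"
    if "k \<in> {..<m}" for k
  proof -
    have *: "subtopology (top_of_set {0..1}) ({real k / real m .. (real k + 1) / real m} \<inter> {0..1})
        = top_of_set ({real k / real m .. (real k + 1) / real m} \<inter> {0..1})"
      by (simp add: subtopology_subtopology Int_commute Int_left_commute)
    show ?thesis
      unfolding *
    proof (rule continuous_map_into_simplex[OF assms(2)])
      show "k < m" using that by simp
      show "continuous_on ({real k / real m .. (real k + 1) / real m} \<inter> {0..1})
          (\<lambda>t. edge_point (w k) (w (Suc k)) (real m * t - real k))"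
        by (intro continuous_on_edge_point continuous_intros)
      show "(\<lambda>t. edge_point (w k) (w (Suc k)) (real m * t - real k)) `
          ({real k / real m .. (real k + 1) / real m} \<inter> {0..1}) \<subseteq> realized_simplex {w k, w (Suc k)}"
      proof (intro image_subsetI edge_point_simplex)
        fix t assume "t \<in> {real k / real m .. (real k + 1) / real m} \<inter> {0..1}"
        then show "0 \<le> real m * t - real k" "real m * t - real k \<le> 1" using mem[of t k] by auto
      qed
    qed
  qed
  show "edge_point (w i) (w (Suc i)) (real m * t - real i) =
      edge_point (w j) (w (Suc j)) (real m * t - real j)"
    if "i \<in> {..<m}" "j \<in> {..<m}"
      "t \<in> topspace (top_of_set {0..1}) \<inter> ({real i / real m .. (real i + 1) / real m} \<inter> {0..1})
        \<inter> ({real j / real m .. (real j + 1) / real m} \<inter> {0..1})" for i j t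
    using polygon_eq[of i m t w] polygon_eq[of j m t w] that mem[of t i] mem[of t j] by simp
  show "\<exists>k. k \<in> {..<m} \<and> t \<in> {real k / real m .. (real k + 1) / real m} \<inter> {0..1} \<and>
      polygon w m t = edge_point (w k) (w (Suc k)) (real m * t - real k)"
    if "t \<in> topspace (top_of_set {0..1})" for t
  proof -
    have t: "0 \<le> t" "t \<le> 1" using that by auto
    have "\<exists>k<m. real k \<le> real m * t \<and> real m * t \<le> real k + 1"
    proof (cases "t = 1")
      case True
      then show ?thesis using assms(1) by (intro exI[of _ "m - 1"]) (simp add: of_nat_diff)
    next
      case False
      then have "real m * t < real m" using t assms(1) by simp
      moreover have "0 \<le> real m * t" using t by simp
      ultimately show ?thesis by (intro exI[of _ "nat \<lfloor>real m * t\<rfloor>"]) linarith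
    qed
    then show ?thesis using polygon_eq[of _ m t w] mem t by auto
  qed
qed auto

text \<open>A null-homotopy of a loop is recorded, on a sufficiently fine grid, by vertices whose open
  stars contain the images of the adjacent cells; the open stars of the four corners of a cell
  then meet, so that these corners span a simplex.\<close>

lemma null_homotopy_grid:
  assumes K: "abstract_simplicial_complex K" and sc: "simply_connected_space (geometric_realization K)"
    and p: "pathin (geometric_realization K) p" "p 0 = vertex_point a" "p 1 = vertex_point a"
    and m: "0 < m"
  obtains M :: nat and v :: "nat \<Rightarrow> nat \<Rightarrow> 'v"
  where "0 < M"
    and "\<And>i j. i < m * M \<Longrightarrow> j < m * M \<Longrightarrow>
      {v j i, v j (Suc i), v (Suc j) i, v (Suc j) (Suc i)} \<in> K"
    and "\<And>j. j \<le> m * M \<Longrightarrow> v j 0 = a \<and> v j (m * M) = a"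
    and "\<And>i. i \<le> m * M \<Longrightarrow> v (m * M) i = a"
    and "\<And>i. i \<le> m * M \<Longrightarrow> 0 < p (real i / real (m * M)) (v 0 i)"
proof -
  let ?X = "geometric_realization K" and ?I = "{0..1::real} \<times> {0..1::real}"
  have "homotopic_with (\<lambda>r. r 0 = p 0 \<and> r 1 = p 0) (top_of_set {0..1}) ?X p (\<lambda>_. p 0)"
    using conjunct2[OF sc[unfolded simply_connected_space_def], THEN spec[of _ p]] p(1)
    by (simp only: p(2,3) simp_thms)
  then obtain h where
    "continuous_map (prod_topology (top_of_set {0..1::real}) (top_of_set {0..1})) ?X h"
    and h: "\<And>x. h (0, x) = p x" "\<And>x. h (1, x) = vertex_point a"
      "\<And>t. t \<in> {0..1} \<Longrightarrow> h (t, 0) = vertex_point a \<and> h (t, 1) = vertex_point a"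
    unfolding homotopic_with_def p(2) by blast
  then have cont: "continuous_map (top_of_set ?I) ?X h"
    by (simp add: subtopology_Times)
  have top: "h z \<in> topspace ?X" if "z \<in> ?I" for z
    using continuous_map_funspace[OF cont] that by auto
  \<comment> \<open>On each member of \<open>\<G>\<close>, inside the square, \<open>h\<close> stays
    in one open star.\<close>
  define \<G> where "\<G> = {T. open T \<and> (\<exists>v. \<forall>z\<in>T \<inter> ?I. 0 < h z v)}"
  have "?I \<subseteq> \<Union>\<G>"
  proof
    fix z assume z: "z \<in> ?I"
    obtain s where "s \<in> K" "h z \<in> realized_simplex s"
      using top[OF z] by (auto simp: topspace_geometric_realization)
    then obtain v where v: "0 < h z v" using realized_simplex_support(2) by blast
    have "openin (top_of_set ?I) {y \<in> topspace (top_of_set ?I). h y \<in> {x \<in> topspace ?X. 0 < x v}}"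
      using openin_continuous_map_preimage[OF cont openin_open_star] .
    then obtain T where T: "open T"
      "{y \<in> topspace (top_of_set ?I). h y \<in> {x \<in> topspace ?X. 0 < x v}} = ?I \<inter> T"
      unfolding openin_open by blast
    have "z \<in> {y \<in> topspace (top_of_set ?I). h y \<in> {x \<in> topspace ?X. 0 < x v}}"
      using z v top[OF z] by simp
    then have "z \<in> T" using T(2) by blast
    moreover have "0 < h y v" if "y \<in> T \<inter> ?I" for y
    proof -
      have "y \<in> {y \<in> topspace (top_of_set ?I). h y \<in> {x \<in> topspace ?X. 0 < x v}}"
        using T(2) that by blast
      then show ?thesis by simp
    qed
    then have "T \<in> \<G>" using T(1) unfolding \<G>_def by blast
    ultimately show "z \<in> \<Union>\<G>" by blast
  qed
  moreover have "compact ?I" by (intro compact_Times compact_Icc)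
  \<comment> \<open>\<open>e\<close> is a Lebesgue number of this cover.\<close>
  ultimately obtain e where e: "0 < e" "\<And>z. z \<in> ?I \<Longrightarrow> \<exists>G\<in>\<G>. ball z e \<subseteq> G"
    using Heine_Borel_lemma[of ?I \<G>] unfolding \<G>_def by blast
  have "\<exists>v. \<forall>y\<in>?I. dist z y < e \<longrightarrow> 0 < h y v" if z: "z \<in> ?I" for z
  proof -
    obtain G where G: "G \<in> \<G>" "ball z e \<subseteq> G" using e(2)[OF z] by blast
    then obtain v where "\<forall>z\<in>G \<inter> ?I. 0 < h z v" unfolding \<G>_def by blast
    then show ?thesis using G(2) by (intro exI[of _ v]) (auto simp: subset_iff)
  qed
  then obtain V where V: "\<And>z y. z \<in> ?I \<Longrightarrow> y \<in> ?I \<Longrightarrow> dist z y < e \<Longrightarrow> 0 < h y (V z)"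
    by metis
  obtain M :: nat where M: "2 / e < real M" using reals_Archimedean2 by blast
  have M0: "0 < M" using M e(1) by (metis divide_pos_pos gr0I less_asym of_nat_0 zero_less_numeral)
  \<comment> \<open>The grid size is a multiple of \<open>m\<close>, so that the points
    \<open>k / m\<close> are grid points. Two corners of a cell are at most \<open>2 / N\<close>
    apart.\<close>
  define N where "N = m * M"
  have N0: "0 < N" using m M0 by (simp add: N_def)
  have "M \<le> N" using m by (simp add: N_def)
  then have "2 / e < real N" using M by linarith
  then have "2 < real N * e" using e(1) by (simp add: pos_divide_less_eq)
  then have Ne: "2 / real N < e" using N0 by (simp add: field_simps)
  define z where "z = (\<lambda>j i. (real j / real N, real i / real N))"
  have zI: "z j i \<in> ?I" if "j \<le> N" "i \<le> N" for i j
    using that N0 by (auto simp: z_def)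
  have V0: "0 < h (z j i) (V (z j i))" if "j \<le> N" "i \<le> N" for i j
    using V[OF zI[OF that] zI[OF that]] e(1) by simp
  \<comment> \<open>The point \<open>vertex_point a\<close> lies in the open star of
    \<open>a\<close> only, which forces the labels on three sides of the square.\<close>
  have vertex: "V (z j i) = a" if "j \<le> N" "i \<le> N" "h (z j i) = vertex_point a" for i j
    using V0[OF that(1,2)] that(3) by (auto simp: vertex_point_def split: if_splits)
  show ?thesis
  proof (rule that[of M "\<lambda>j i. V (z j i)", folded N_def])
    show "0 < M" by (rule M0)
    show "{V (z j i), V (z j (Suc i)), V (z (Suc j) i), V (z (Suc j) (Suc i))} \<in> K"
      if ij: "i < N" "j < N" for i j
    proof (rule support_face[OF K top[OF zI[of j i]]])
      \<comment> \<open>All corners of the cell are closer than \<open>e\<close> to its corner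
        \<open>z j i\<close>, so the image of that one corner lies in the open stars of all four
        labels.\<close>
      have near: "0 < h (z j i) (V (z j' i'))"
        if "j' = j \<or> j' = Suc j" "i' = i \<or> i' = Suc i" for i' j'
      proof (rule V)
        have "dist (z j' i') (z j i) \<le> \<bar>real j' / N - real j / N\<bar> + \<bar>real i' / N - real i / N\<bar>"
          unfolding z_def dist_Pair_Pair dist_real_def by (rule sqrt_sum_squares_le_sum_abs[THEN order_trans]) simp
        also have "\<dots> \<le> 1 / N + 1 / N"
          using that by (intro add_mono) (auto simp: diff_divide_distrib[symmetric])
        finally show "dist (z j' i') (z j i) < e" using Ne by simp
      qed (use zI ij that in auto)
      show "0 < h (z j i) u"
        if "u \<in> {V (z j i), V (z j (Suc i)), V (z (Suc j) i), V (z (Suc j) (Suc i))}" for u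
        using that near by blast
    qed (use ij in auto)
    show "V (z j 0) = a \<and> V (z j N) = a" if "j \<le> N" for j
    proof -
      have "real j / real N \<in> {0..1}" using that N0 by auto
      then show ?thesis using vertex[of j 0] vertex[of j N] that N0 h(3) by (simp add: z_def)
    qed
    show "V (z N i) = a" if "i \<le> N" for i
      using vertex[of N i] that N0 h(2) by (simp add: z_def)
    show "0 < p (real i / real N) (V (z 0 i))" if "i \<le> N" for i
      using V0[of 0 i] that h(1) by (simp add: z_def)
  qed
qed

text \<open>The open stars of the vertices inside \<open>C\<close> and of those outside form two
  open sets covering the space; a common point would give an edge leaving \<open>C\<close>. As
  \<open>C\<close> contains \<open>a\<close>, connectedness leaves no vertex outside.\<close>

lemma connected_vertices:
  assumes K: "abstract_simplicial_complex K" and con: "path_connected_space (geometric_realization K)"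
    and a: "{a} \<in> K" "a \<in> C" and v: "{v} \<in> K"
    and closed: "\<And>x y. x \<in> C \<Longrightarrow> {x, y} \<in> K \<Longrightarrow> y \<in> C"
  shows "v \<in> C"
proof (rule ccontr)
  assume "v \<notin> C"
  let ?X = "geometric_realization K"
  let ?U = "\<lambda>A. \<Union>v\<in>A. {x \<in> topspace ?X. 0 < x v}"
  have "openin ?X (?U A)" for A by (intro openin_Union ballI) (auto intro: openin_open_star)
  moreover have "topspace ?X \<subseteq> ?U C \<union> ?U (- C)"
  proof
    fix x assume x: "x \<in> topspace ?X"
    then obtain u where "0 < x u"
      using realized_simplex_support(2) by (force simp: topspace_geometric_realization)
    then show "x \<in> ?U C \<union> ?U (- C)" using x by blast
  qed
  moreover have "?U C \<inter> ?U (- C) = {}"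
  proof -
    have False if "x \<in> topspace ?X" "0 < x u" "0 < x w" "u \<in> C" "w \<notin> C" for x u w
      using support_face[OF K that(1), of "{u, w}"] closed[OF that(4)] that by auto
    then show ?thesis by blast
  qed
  moreover have "vertex_point a \<in> ?U C"
    using vertex_point_topspace[OF a(1)] a(2) by (auto simp: vertex_point_def intro!: bexI[of _ a])
  moreover have "vertex_point v \<in> ?U (- C)"
    using vertex_point_topspace[OF v] \<open>v \<notin> C\<close> by (auto simp: vertex_point_def intro!: bexI[of _ v])
  ultimately show False
    using path_connected_imp_connected_space[OF con] unfolding connected_space_def by blast
qed


section \<open>Monodromy of simplicial coverings\<close>

text \<open>A covering map in combinatorial form: \<open>R\<close> is adjacency in the total space,
  made reflexive so that a walk pausing at a vertex lifts too. Edges lift uniquely, and two lifted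
  edges spanning a simplex below close up to a triangle.\<close>

locale simplicial_covering =
  fixes K :: "'v set set" and E :: "'s set" and R :: "'s \<Rightarrow> 's \<Rightarrow> bool" and e :: "'s \<Rightarrow> 'v"
  assumes complex: "abstract_simplicial_complex K"
    and lift_exists: "s \<in> E \<Longrightarrow> {e s, x} \<in> K \<Longrightarrow> \<exists>t\<in>E. R s t \<and> e t = x"
    and lift_unique: "R s t \<Longrightarrow> R s u \<Longrightarrow> e t = e u \<Longrightarrow> t = u"
    and lift_refl: "R s s"
    and lift_simplex: "R s t \<Longrightarrow> R s u \<Longrightarrow> {e s, e t, e u} \<in> K \<Longrightarrow> R t u"
begin

lemma face: "s \<in> K \<Longrightarrow> t \<subseteq> s \<Longrightarrow> t \<noteq> {} \<Longrightarrow> t \<in> K"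
  by (rule abstract_simplicial_complex_face[OF complex])

definition lift :: "'s \<Rightarrow> 'v \<Rightarrow> 's" where
  "lift s x = (THE t. t \<in> E \<and> R s t \<and> e t = x)"

lemma lift_eq: "t \<in> E \<Longrightarrow> R s t \<Longrightarrow> lift s (e t) = t"
  unfolding lift_def by (rule the_equality) (use lift_unique in blast)+

lemma lift:
  assumes "s \<in> E" "{e s, x} \<in> K"
  shows "lift s x \<in> E" "R s (lift s x)" "e (lift s x) = x"
  using lift_exists[OF assms] lift_eq by force+

lemma lift_self: "s \<in> E \<Longrightarrow> lift s (e s) = s"
  by (rule lift_eq) (auto intro: lift_refl)

text \<open>Across one simplex the lifts of \<open>x\<close> and \<open>y\<close> from
  \<open>s\<close> are \<open>R\<close>-related, and uniqueness makes the latter the lift of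
  \<open>y\<close> from the former.\<close>

lemma lift_lift:
  assumes s: "s \<in> E" and K: "{e s, x, y} \<in> K"
  shows "lift (lift s x) y = lift s y"
proof -
  have x: "{e s, x} \<in> K" and y: "{e s, y} \<in> K" using face[OF K] by auto
  have "R (lift s x) (lift s y)"
    using lift_simplex[OF lift(2)[OF s x] lift(2)[OF s y]] lift(3)[OF s x] lift(3)[OF s y] K by simp
  then have "lift (lift s x) (e (lift s y)) = lift s y"
    by (rule lift_eq[OF lift(1)[OF s y]])
  then show ?thesis by (simp only: lift(3)[OF s y])
qed

primrec transport :: "'s \<Rightarrow> (nat \<Rightarrow> 'v) \<Rightarrow> nat \<Rightarrow> 's" where
  "transport s v 0 = s"
| "transport s v (Suc i) = lift (transport s v i) (v (Suc i))"

lemma transport: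
  assumes "s \<in> E" "e s = v 0" "\<And>i. i < n \<Longrightarrow> {v i, v (Suc i)} \<in> K" "i \<le> n"
  shows "transport s v i \<in> E \<and> e (transport s v i) = v i"
  using assms(4)
proof (induction i)
  case (Suc i)
  then have "transport s v i \<in> E" "{e (transport s v i), v (Suc i)} \<in> K"
    using assms(3)[of i] by auto
  then show ?case using lift by simp
qed (use assms in simp)

text \<open>In each cell the route through \<open>w i\<close> and the route through
  \<open>v (Suc i)\<close> both shorten to the direct lift of \<open>w (Suc i)\<close> by
  \<open>lift_lift\<close>.\<close>

lemma transport_adjacent:
  assumes s: "s \<in> E" "e s = v 0" "v 0 = w 0"
    and cell: "\<And>i. i < n \<Longrightarrow> {v i, v (Suc i), w i, w (Suc i)} \<in> K"
    and "i \<le> n"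
  shows "transport s w i = lift (transport s v i) (w i)"
  using \<open>i \<le> n\<close>
proof (induction i)
  case 0
  then show ?case using lift_self[OF s(1)] s by simp
next
  case (Suc i)
  have v: "{v i, v (Suc i)} \<in> K" if "i < n" for i using face[OF cell[OF that]] by simp
  have t: "transport s v i \<in> E" "e (transport s v i) = v i"
    using transport[OF s(1,2) v] Suc by auto
  have c: "{v i, w i, w (Suc i)} \<in> K" "{v i, v (Suc i), w (Suc i)} \<in> K"
    using face[OF cell[of i]] Suc by auto
  have "transport s w (Suc i) = lift (lift (transport s v i) (w i)) (w (Suc i))"
    using Suc by simp
  also have "\<dots> = lift (transport s v i) (w (Suc i))"
    by (rule lift_lift) (use t c in simp_all)
  also have "\<dots> = lift (lift (transport s v i) (v (Suc i))) (w (Suc i))"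
    by (rule lift_lift[symmetric]) (use t c in simp_all)
  finally show ?case by simp
qed

text \<open>A null-homotopy of the projected walk is sampled on a grid. Consecutive rows have lifts
  with the same end, the top row is constant and so is its lift, and the bottom row subdivides the
  walk, so that its lift follows \<open>s\<close>.\<close>

lemma closed_walk_lift:
  assumes sc: "simply_connected_space (geometric_realization K)"
    and s: "\<And>k. k \<le> m \<Longrightarrow> s k \<in> E" "\<And>k. k < m \<Longrightarrow> R (s k) (s (Suc k))"
      "\<And>k. k < m \<Longrightarrow> {e (s k), e (s (Suc k))} \<in> K"
    and "e (s m) = e (s 0)" "0 < m"
  shows "s m = s 0"
proof -
  define w where "w = (\<lambda>k. e (s k))"
  define a where "a = w 0"
  have p0: "polygon w m 0 = vertex_point a" "polygon w m 1 = vertex_point a"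
    using polygon_vertex[of 0 m w] polygon_vertex[of m m w] assms(5,6) by (auto simp: a_def w_def)
  have "pathin (geometric_realization K) (polygon w m)"
    by (rule pathin_polygon) (use assms in \<open>auto simp: w_def\<close>)
  then obtain M v where M: "0 < M"
    and cell: "\<And>i j. i < m * M \<Longrightarrow> j < m * M \<Longrightarrow>
      {v j i, v j (Suc i), v (Suc j) i, v (Suc j) (Suc i)} \<in> K"
    and side: "\<And>j. j \<le> m * M \<Longrightarrow> v j 0 = a \<and> v j (m * M) = a"
    and top: "\<And>i. i \<le> m * M \<Longrightarrow> v (m * M) i = a"
    and bottom: "\<And>i. i \<le> m * M \<Longrightarrow> 0 < polygon w m (real i / real (m * M)) (v 0 i)"
    using null_homotopy_grid[OF complex sc _ p0 assms(6)] by metis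
  let ?N = "m * M"
  have N: "0 < ?N" using M assms(6) by simp
  have s0: "s 0 \<in> E" "e (s 0) = v j 0" if "j \<le> ?N" for j
    using s(1)[of 0] side[OF that] by (auto simp: a_def w_def)
  have edge: "{v j i, v j (Suc i)} \<in> K" if ij: "i < ?N" "j \<le> ?N" for i j
  proof (cases "j < ?N")
    case True
    show ?thesis by (rule face[OF cell[OF ij(1) True]]) auto
  next
    case False
    then obtain k where "j = Suc k" "k < ?N" using ij(2) N by (cases j) auto
    then show ?thesis using face[OF cell[OF ij(1), of k], of "{v j i, v j (Suc i)}"] by auto
  qed
  have row: "transport (s 0) (v (Suc j)) ?N = transport (s 0) (v j) ?N" if "j < ?N" for j
  proof -
    have t: "transport (s 0) (v j) ?N \<in> E" "e (transport (s 0) (v j) ?N) = a"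
      using transport[OF s0[of j] edge, of ?N ?N] side[of j] that by auto
    have "transport (s 0) (v (Suc j)) ?N = lift (transport (s 0) (v j) ?N) (v (Suc j) ?N)"
      by (rule transport_adjacent[where n = ?N])
        (use s0[of j] side[of j] side[of "Suc j"] cell that in auto)
    also have "\<dots> = transport (s 0) (v j) ?N"
      using lift_self[OF t(1)] t(2) side[of "Suc j"] that by simp
    finally show ?thesis .
  qed
  have rows: "transport (s 0) (v j) ?N = transport (s 0) (v 0) ?N" if "j \<le> ?N" for j
    using that
  proof (induction j)
    case (Suc j)
    then show ?case using row[of j] by simp
  qed simp
  have top_row: "transport (s 0) (v ?N) i = s 0" if "i \<le> ?N" for i
    using that
  proof (induction i)
    case (Suc i)
    then show ?case using top[of "Suc i"] lift_self[of "s 0"] s(1)[of 0] by (simp add: a_def w_def)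
  qed simp
  have closed: "transport (s 0) (v 0) ?N = s 0"
    using rows[of ?N] top_row[of ?N] by (metis order_refl)
  \<comment> \<open>The grid points of block \<open>k\<close> lie on the edge from
    \<open>w k\<close> to \<open>w (Suc k)\<close>, where no other coordinate is positive.\<close>
  have bottom_edge: "v 0 (k * M + i) \<in> {w k, w (Suc k)}" if "k < m" "i \<le> M" for k i
  proof -
    have "k * M + i \<le> Suc k * M" using that by simp
    also have "\<dots> \<le> ?N" using that(1) by (intro mult_le_mono1) simp
    finally have le: "k * M + i \<le> ?N" .
    have eq: "real m * (real (k * M + i) / real ?N) = real k + real i / real M"
      using M assms(6) by (simp add: field_simps)
    have "real i / real M \<le> 1" using that(2) M by simp
    then have "polygon w m (real (k * M + i) / real ?N) \<in> realized_simplex {w k, w (Suc k)}"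
      using polygon_eq[OF that(1), of "real (k * M + i) / real ?N" w] eq
      by (simp add: edge_point_simplex)
    then show ?thesis using realized_simplex_support(1) bottom[OF le] by blast
  qed
  have bottom_vertex: "v 0 (k * M) = w k" if "k \<le> m" for k
  proof -
    have "real (k * M) / real ?N = real k / real m" using M by simp
    then show ?thesis
      using bottom[of "k * M"] polygon_vertex[OF that assms(6), of w] that
      by (auto simp: vertex_point_def split: if_splits)
  qed
  have "transport (s 0) (v 0) (k * M) = s k" if "k \<le> m" for k
    using that
  proof (induction k)
    case (Suc k)
    then have k: "k < m" by simp
    have K: "{w k, w (Suc k)} \<in> K" using s(3)[OF k] by (simp add: w_def)
    \<comment> \<open>All labels of the block lie in one edge, so the successive lifts collapse to a
      single lift from \<open>s k\<close>.\<close>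
    have "transport (s 0) (v 0) (k * M + i) = lift (s k) (v 0 (k * M + i))" if "i \<le> M" for i
      using that
    proof (induction i)
      case 0
      then show ?case using Suc lift_self[OF s(1)] bottom_vertex[of k] k by (simp add: w_def)
    next
      case (Suc i)
      have "lift (lift (s k) (v 0 (k * M + i))) (v 0 (Suc (k * M + i))) = lift (s k) (v 0 (Suc (k * M + i)))"
      proof (rule lift_lift)
        have "{e (s k), v 0 (k * M + i), v 0 (Suc (k * M + i))} \<subseteq> {w k, w (Suc k)}"
          using bottom_edge[OF k, of i] bottom_edge[OF k, of "Suc i"] Suc.prems by (auto simp: w_def)
        then show "{e (s k), v 0 (k * M + i), v 0 (Suc (k * M + i))} \<in> K"
          using face[OF K] by blast
      qed (use s(1) k in simp)
      then show ?case using Suc by simp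
    qed
    from this[of M] have "transport (s 0) (v 0) (Suc k * M) = lift (s k) (v 0 (Suc k * M))"
      by (simp add: add.commute)
    also have "\<dots> = lift (s k) (e (s (Suc k)))" using bottom_vertex[OF Suc.prems] by (simp add: w_def)
    also have "\<dots> = s (Suc k)" using lift_eq s k by simp
    finally show ?case .
  qed simp
  from this[of m] show ?thesis using closed by simp
qed

end


section \<open>Path metrics\<close>

definition reach :: "'v ugraph \<Rightarrow> nat \<Rightarrow> 'v \<Rightarrow> 'v \<Rightarrow> bool" where
  "reach G n u v \<longleftrightarrow> (\<exists>p. is_walk G p \<and> hd p = u \<and> last p = v \<and> length p = Suc n)"

lemma reach_0 [simp]: "reach G 0 u v \<longleftrightarrow> u \<in> verts G \<and> u = v"
proof
  assume "reach G 0 u v"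
  then show "u \<in> verts G \<and> u = v"
    by (auto simp: reach_def is_walk_def length_Suc_conv)
next
  assume "u \<in> verts G \<and> u = v"
  then show "reach G 0 u v"
    unfolding reach_def by (intro exI[of _ "[u]"]) (auto simp: is_walk_def)
qed

lemma is_walk_Cons: "is_walk G (u # w # p) \<longleftrightarrow> u \<in> verts G \<and> {u, w} \<in> edges G \<and> is_walk G (w # p)"
  using All_less_Suc2[of "length p" "\<lambda>i. {(u # w # p) ! i, (w # p) ! i} \<in> edges G"]
  by (auto simp: is_walk_def)

lemma reach_Suc:
  "reach G (Suc n) u v \<longleftrightarrow> u \<in> verts G \<and> (\<exists>w. {u, w} \<in> edges G \<and> reach G n w v)"
proof
  assume "reach G (Suc n) u v"
  then obtain p where p: "is_walk G p" "hd p = u" "last p = v" "length p = Suc (Suc n)"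
    by (auto simp: reach_def)
  then obtain w q where q: "p = u # w # q" by (metis length_Suc_conv list.sel(1))
  then have "reach G n w v" using p unfolding reach_def
    by (intro exI[of _ "w # q"]) (auto simp: is_walk_Cons)
  then show "u \<in> verts G \<and> (\<exists>w. {u, w} \<in> edges G \<and> reach G n w v)"
    using p(1) unfolding q is_walk_Cons by blast
next
  assume "u \<in> verts G \<and> (\<exists>w. {u, w} \<in> edges G \<and> reach G n w v)"
  then obtain w p where u: "u \<in> verts G" "{u, w} \<in> edges G"
    and p: "is_walk G p" "hd p = w" "last p = v" "length p = Suc n"
    by (auto simp: reach_def)
  then obtain q where "p = w # q" by (metis length_Suc_conv list.sel(1))
  then show "reach G (Suc n) u v"
    using u p is_walk_Cons[of G u w q] unfolding reach_def by (intro exI[of _ "u # p"]) simp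
qed

lemma reach_verts: "reach G n u v \<Longrightarrow> u \<in> verts G \<and> v \<in> verts G"
  by (induction n arbitrary: u) (auto simp: reach_Suc)

lemma reach_trans: "reach G n u v \<Longrightarrow> reach G m v w \<Longrightarrow> reach G (n + m) u w"
  by (induction n arbitrary: u) (auto simp: reach_Suc)

lemma reach_sym: "reach G n u v \<Longrightarrow> reach G n v u"
proof (induction n arbitrary: u)
  case (Suc n)
  then obtain w where w: "u \<in> verts G" "{u, w} \<in> edges G" "reach G n w v" by (auto simp: reach_Suc)
  then have "reach G (Suc 0) w u"
    using reach_verts[OF w(3)] by (auto simp: reach_Suc insert_commute)
  then show ?case using reach_trans[OF Suc.IH[OF w(3)]] by fastforce
qed auto

lemma path_metric_reach: "path_metric G u v = real (Inf {n. reach G n u v})"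
proof -
  have "{length p - 1 | p. is_walk G p \<and> hd p = u \<and> last p = v} = {n. reach G n u v}"
  proof (intro set_eqI iffI)
    fix n assume "n \<in> {length p - 1 | p. is_walk G p \<and> hd p = u \<and> last p = v}"
    then obtain p where p: "n = length p - 1" "is_walk G p" "hd p = u" "last p = v" by blast
    then have "length p = Suc n" by (cases p) (simp_all add: is_walk_def)
    then show "n \<in> {n. reach G n u v}" using p(2-4) unfolding reach_def by blast
  next
    fix n assume "n \<in> {n. reach G n u v}"
    then show "n \<in> {length p - 1 | p. is_walk G p \<and> hd p = u \<and> last p = v}"
      by (force simp: reach_def)
  qed
  then show ?thesis by (simp add: path_metric_def)
qed

lemma path_metric_le: "reach G n u v \<Longrightarrow> path_metric G u v \<le> real n"
  unfolding path_metric_reach by (simp add: wellorder_Inf_le1)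

text \<open>The given walk rules out the default value 0 of the empty infimum; a nonempty set of
  naturals contains its infimum.\<close>

lemma path_metric_attained:
  assumes "reach G n u v" obtains m where "reach G m u v" "path_metric G u v = real m"
  using Inf_nat_def1[of "{n. reach G n u v}"] assms unfolding path_metric_reach by blast

text \<open>Connectedness makes every distance the length of an actual walk, so distance 0 means
  equal end points, and shortest walks can be concatenated.\<close>

lemma Metric_space_path_metric:
  assumes "\<And>u v. u \<in> verts G \<Longrightarrow> v \<in> verts G \<Longrightarrow> \<exists>n. reach G n u v"
  shows "Metric_space (verts G) (path_metric G)"
proof -
  have attained: "\<exists>n. reach G n u v \<and> path_metric G u v = real n"
    if "u \<in> verts G" "v \<in> verts G" for u v
    using assms[OF that] by (elim exE) (rule path_metric_attained, assumption, blast)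
  show ?thesis
  proof
    show "0 \<le> path_metric G u v" for u v by (simp add: path_metric_def)
    show "path_metric G u v = path_metric G v u" for u v
    proof -
      have "reach G n u v \<longleftrightarrow> reach G n v u" for n by (rule iffI; erule reach_sym)
      then show ?thesis by (simp add: path_metric_reach)
    qed
    show "path_metric G u v = 0 \<longleftrightarrow> u = v" if uv: "u \<in> verts G" "v \<in> verts G" for u v
    proof
      assume "u = v"
      then have "reach G 0 u v" using uv by simp
      then have "path_metric G u v \<le> real 0" by (rule path_metric_le)
      then show "path_metric G u v = 0" by (simp add: path_metric_def)
    qed (use attained[OF uv] in auto)
    show "path_metric G u w \<le> path_metric G u v + path_metric G v w"
      if uvw: "u \<in> verts G" "v \<in> verts G" "w \<in> verts G" for u v w
    proof -
      obtain n where n: "reach G n u v" "path_metric G u v = real n" using attained[OF uvw(1,2)] by blast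
      obtain m where m: "reach G m v w" "path_metric G v w = real m" using attained[OF uvw(2,3)] by blast
      show ?thesis
        using path_metric_le[OF reach_trans[OF n(1) m(1)]] n(2) m(2) by simp
    qed
  qed
qed

text \<open>The identity is bilipschitz: walks in \<open>H\<close> are walks in \<open>G\<close>,
  and each edge of a walk in \<open>G\<close> is replaced by at most two edges of
  \<open>H\<close>.\<close>

lemma quasi_isometric_path_metrics:
  assumes verts: "verts H = verts G" and connected: "\<And>u v. u \<in> verts G \<Longrightarrow> v \<in> verts G \<Longrightarrow> \<exists>n. reach G n u v"
    and sub: "edges H \<subseteq> edges G"
    and detour: "\<And>u v. u \<in> verts G \<Longrightarrow> {u, v} \<in> edges G \<Longrightarrow> \<exists>m\<le>2. reach H m u v"
  shows "quasi_isometric (verts G) (path_metric G) (verts H) (path_metric H)"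
proof -
  have GH: "reach H n u v \<Longrightarrow> reach G n u v" for n u v
    using sub by (induction n arbitrary: u) (auto simp: reach_Suc verts)
  have HG: "reach G n u v \<Longrightarrow> \<exists>m\<le>2 * n. reach H m u v" for n u v
  proof (induction n arbitrary: u)
    case (Suc n)
    then obtain w where w: "u \<in> verts G" "{u, w} \<in> edges G" "reach G n w v" by (auto simp: reach_Suc)
    obtain m where m: "m \<le> 2" "reach H m u w" using detour[OF w(1,2)] by blast
    obtain k where k: "k \<le> 2 * n" "reach H k w v" using Suc.IH[OF w(3)] by blast
    show ?case using reach_trans[OF m(2) k(2)] m(1) k(1) by (intro exI[of _ "m + k"]) simp
  qed (simp add: verts)
  have bounds: "path_metric G u v \<le> path_metric H u v \<and> path_metric H u v \<le> 2 * path_metric G u v"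
    if uv: "u \<in> verts G" "v \<in> verts G" for u v
  proof -
    obtain n where n: "reach G n u v" "path_metric G u v = real n"
      using connected[OF uv] by (elim exE) (rule path_metric_attained)
    obtain k where k: "k \<le> 2 * n" "reach H k u v" using HG[OF n(1)] by blast
    obtain m where m: "reach H m u v" "path_metric H u v = real m"
      using path_metric_attained[OF k(2)] .
    show ?thesis
      using path_metric_le[OF GH[OF m(1)]] path_metric_le[OF k(2)] k(1) n(2) m(2) by simp
  qed
  have G: "Metric_space (verts G) (path_metric G)"
    by (rule Metric_space_path_metric) (rule connected)
  have H: "Metric_space (verts H) (path_metric H)"
    by (rule Metric_space_path_metric) (use connected HG verts in blast)
  show ?thesis
    unfolding quasi_isometric_def
  proof (intro conjI G H, rule exI[of _ id], rule exI[of _ 2], rule exI[of _ 0], intro conjI ballI)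
    fix u v assume uv: "u \<in> verts G" "v \<in> verts G"
    show "path_metric G u v / 2 - 0 \<le> path_metric H (id u) (id v)"
      using bounds[OF uv] Metric_space.nonneg[OF G, of u v] by simp
    show "path_metric H (id u) (id v) \<le> 2 * path_metric G u v + 0"
      using bounds[OF uv] by simp
  next
    fix z assume "z \<in> verts H"
    then show "\<exists>x\<in>verts G. path_metric H z (id x) \<le> 0"
      using verts Metric_space.zero[OF H, of z z] by (intro bexI[of _ z]) auto
  qed (use verts in auto)
qed


section \<open>The universal cover of a systolic complex\<close>

text \<open>A state is a vertex of the universal cover: its image, together with the one or two states
  preceding it on geodesics towards the base point.\<close>

datatype 'v state = State (pt: 'v) (pred_fset: "'v state fset")

abbreviation preds :: "'v state \<Rightarrow> 'v state set" where
  "preds s \<equiv> fset (pred_fset s)"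

locale based_systolic =
  fixes K :: "'v set set" and b :: 'v
  assumes systolic: "systolic_2_complex K"
    and base: "{b} \<in> K"
begin

lemma complex: "abstract_simplicial_complex K"
  using systolic by (simp add: systolic_2_complex_def)

lemma face: "s \<in> K \<Longrightarrow> t \<subseteq> s \<Longrightarrow> t \<noteq> {} \<Longrightarrow> t \<in> K"
  by (rule abstract_simplicial_complex_face[OF complex])

section \<open>Triangles and short cycles in links\<close>

definition tri :: "'v \<Rightarrow> 'v \<Rightarrow> 'v \<Rightarrow> bool" where
  "tri x y z \<longleftrightarrow> {x, y, z} \<in> K \<and> x \<noteq> y \<and> y \<noteq> z \<and> x \<noteq> z"

lemma tri_swap: "tri x y z \<longleftrightarrow> tri y x z" "tri x y z \<longleftrightarrow> tri x z y"
  by (auto simp: tri_def insert_commute)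

lemma tri_edge: "tri x y z \<Longrightarrow> {x, y} \<in> K"
  unfolding tri_def by (rule face[of "{x, y, z}"]) auto

text \<open>A cyclic sequence of triangles around \<open>v\<close> is an embedded cycle in the link
  of \<open>v\<close>, whose girth is at least 6.\<close>

lemma link_cycle_length:
  assumes "distinct c" "3 \<le> length c"
    and edge: "\<And>i. i < length c \<Longrightarrow> tri v (c ! i) (c ! (Suc i mod length c))"
  shows "6 \<le> length c"
proof -
  let ?G = "vertex_link K v"
  have v: "{v, c ! i} \<in> K" "v \<noteq> c ! i" if "i < length c" for i
    using tri_edge[OF edge[OF that]] edge[OF that] by (simp_all add: tri_def)
  have "{v} \<in> K"
    by (rule face[OF v(1)[of 0]]) (use assms(2) in auto)
  then have "6 \<le> girth ?G"
    using systolic by (simp add: systolic_2_complex_def one_skeleton_def)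
  moreover have "embedded_cycle ?G c"
  proof -
    have "set c \<subseteq> verts ?G" using v by (force simp: in_set_conv_nth vertex_link_def)
    moreover have "{c ! i, c ! (Suc i mod length c)} \<in> edges ?G" if "i < length c" for i
      using edge[OF that] by (simp add: vertex_link_def tri_def)
    then have "cycle_edges c \<subseteq> edges ?G" by (auto simp: cycle_edges_def)
    ultimately show ?thesis using assms by (simp add: embedded_cycle_def)
  qed
  then have "girth ?G \<le> enat (length c)"
    unfolding girth_def by (intro Inf_lower) blast
  ultimately have "6 \<le> enat (length c)" by (rule order_trans)
  then show ?thesis by (simp add: numeral_eq_enat)
qed

lemma no_3_cycle:
  assumes "tri v x y" "tri v y z" "tri v z x"
  shows False
proof -
  have "6 \<le> length [x, y, z]"
    by (rule link_cycle_length[of _ v])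
      (use assms in \<open>auto simp: tri_def less_Suc_eq\<close>)
  then show False by simp
qed

text \<open>Consecutive vertices differ by \<open>tri\<close>, so for an embedded cycle only the
  diagonal pairs have to be separated.\<close>

lemma no_4_cycle:
  assumes "tri v x y" "tri v y z" "tri v z w" "tri v w x" "x \<noteq> z" "y \<noteq> w"
  shows False
proof -
  have "6 \<le> length [x, y, z, w]"
    by (rule link_cycle_length[of _ v])
      (use assms in \<open>auto simp: tri_def less_Suc_eq\<close>)
  then show False by simp
qed

lemma no_5_cycle:
  assumes "tri v x y" "tri v y z" "tri v z w" "tri v w u" "tri v u x"
    and "x \<noteq> z" "x \<noteq> w" "y \<noteq> w" "y \<noteq> u" "z \<noteq> u"
  shows False
proof -
  have "6 \<le> length [x, y, z, w, u]"
    by (rule link_cycle_length[of _ v])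
      (use assms in \<open>auto simp: tri_def less_Suc_eq\<close>)
  then show False by simp
qed

section \<open>Layers of the universal cover\<close>

definition horiz :: "'v state \<Rightarrow> 'v state \<Rightarrow> bool" where
  "horiz s t \<longleftrightarrow> (\<exists>r\<in>preds s \<inter> preds t. tri (pt r) (pt s) (pt t))"

text \<open>A neighbour \<open>x\<close> of \<open>pt s\<close> is fresh if its distance in the link of \<open>pt s\<close> from the
  predecessors of \<open>s\<close> is at least two; its lift then lies one layer further from the root.\<close>

definition fresh :: "'v state \<Rightarrow> 'v \<Rightarrow> bool" where
  "fresh s x \<longleftrightarrow> {pt s, x} \<in> K \<and> x \<noteq> pt s \<and> (\<forall>r\<in>preds s. {pt s, pt r, x} \<notin> K)"

text \<open>The states of the layer \<open>M\<close> whose lifts of \<open>x\<close> must be identified with that of \<open>s\<close>.\<close>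

definition cluster :: "'v state set \<Rightarrow> 'v state \<Rightarrow> 'v \<Rightarrow> 'v state set" where
  "cluster M s x = insert s {t \<in> M. horiz s t \<and> tri (pt s) (pt t) x}"

text \<open>A new state stores the whole cluster. Lifts of \<open>x\<close> from members that see
  the same cluster are thereby equal, while lifts from different clusters stay apart even over the
  same vertex.\<close>

primrec layer :: "nat \<Rightarrow> 'v state set" where
  "layer 0 = {State b {||}}"
| "layer (Suc n) = {State x F | x F. \<exists>s\<in>layer n. fresh s x \<and> fset F = cluster (layer n) s x}"

text \<open>The induction hypothesis of the construction: \<open>preds s\<close> is a cluster, seen from any of its
  members.\<close>

definition coherent :: "nat \<Rightarrow> bool" where
  "coherent n \<longleftrightarrow> (\<forall>s\<in>layer n. \<forall>p\<in>preds s. \<exists>m. n = Suc m \<and> p \<in> layer m \<and>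
     fresh p (pt s) \<and> preds s = cluster (layer m) p (pt s))"

section \<open>Neighbours and clusters within a coherent layer\<close>

lemma horiz_sym: "horiz s t \<Longrightarrow> horiz t s"
  unfolding horiz_def using tri_swap by blast

text \<open>By coherence the predecessors of \<open>s\<close> form a cluster seen from
  \<open>p\<close>, so any other one is adjacent to \<open>p\<close> and spans a triangle with
  \<open>pt p\<close> and \<open>pt s\<close>.\<close>

lemma preds_edge:
  assumes "coherent n" "s \<in> layer n" "p \<in> preds s" "q \<in> preds s" "p \<noteq> q"
  shows "horiz p q" "tri (pt s) (pt p) (pt q)"
  using assms unfolding coherent_def cluster_def
  by (metis (no_types, lifting) insert_iff mem_Collect_eq,
      metis (no_types, lifting) insert_iff mem_Collect_eq tri_swap)

lemma horiz_not_fresh: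
  assumes "horiz s t" shows "\<not> fresh s (pt t)"
proof -
  obtain r where "r \<in> preds s" "tri (pt s) (pt r) (pt t)"
    using assms by (auto simp: horiz_def tri_swap)
  then show ?thesis unfolding fresh_def tri_def by blast
qed

text \<open>Otherwise a common predecessor \<open>r\<close> of \<open>s\<close> and \<open>t\<close>
  is horizontally adjacent to \<open>q\<close>, which lies over \<open>pt t\<close>, whereas
  \<open>pt t\<close> is fresh at \<open>r\<close>.\<close>

lemma horiz_pt_not_preds:
  assumes "coherent n" "s \<in> layer n" "t \<in> layer n" "horiz s t" "q \<in> preds s"
  shows "pt t \<noteq> pt q"
proof
  assume eq: "pt t = pt q"
  obtain r where r: "r \<in> preds s" "r \<in> preds t" "tri (pt r) (pt s) (pt t)"
    using assms(4) by (auto simp: horiz_def)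
  then have "r \<noteq> q" using eq by (auto simp: tri_def)
  then have "horiz r q" using preds_edge(1)[OF assms(1,2) r(1) assms(5)] by blast
  moreover have "fresh r (pt t)" using assms(1,3) r(2) unfolding coherent_def by blast
  ultimately show False using horiz_not_fresh eq by metis
qed

text \<open>Coherence recovers all predecessors, as a cluster, from the point and any one of
  them.\<close>

lemma layer_ext:
  assumes "coherent n" "s \<in> layer n" "t \<in> layer n" "r \<in> preds s" "r \<in> preds t" "pt s = pt t"
  shows "s = t"
proof -
  obtain m where m: "n = Suc m" "preds s = cluster (layer m) r (pt s)"
    using assms unfolding coherent_def by blast
  then have "preds t = cluster (layer m) r (pt t)"
    using assms unfolding coherent_def by blast
  then show ?thesis using m assms(6) by (metis fset_inject state.expand)
qed

text \<open>Two different common predecessors would be adjacent and form with \<open>pt t\<close> a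
  3-cycle in the link of \<open>pt s\<close>. With a single one, \<open>layer_ext\<close>
  applies.\<close>

lemma horiz_unique:
  assumes c: "coherent n" "s \<in> layer n" "t \<in> layer n" "u \<in> layer n"
    and h: "horiz s t" "horiz s u" and eq: "pt t = pt u"
  shows "t = u"
proof -
  obtain r where r: "r \<in> preds s" "r \<in> preds t" "tri (pt r) (pt s) (pt t)"
    using h(1) by (auto simp: horiz_def)
  obtain q where q: "q \<in> preds s" "q \<in> preds u" "tri (pt q) (pt s) (pt u)"
    using h(2) by (auto simp: horiz_def)
  have "r = q"
  proof (rule ccontr)
    assume "r \<noteq> q"
    then have "tri (pt s) (pt r) (pt q)" using preds_edge[OF c(1,2) r(1) q(1)] by blast
    then show False using no_3_cycle[of "pt s" "pt r" "pt q" "pt t"] r q eq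
          by (simp add: tri_swap)
  qed
  then show ?thesis using layer_ext[OF c(1,3,4)] r q eq by blast
qed

lemma fresh_not_pred:
  assumes "fresh s x" "r \<in> preds s" "tri (pt r) (pt s) y" shows "x \<noteq> pt r"
proof
  assume "x = pt r"
  then have "{pt s, pt r} \<notin> K" using assms(1,2) by (auto simp: fresh_def)
  then show False using tri_edge[OF assms(3)] by (simp add: insert_commute)
qed

text \<open>A second partner would close up a cycle of length four or five in the link of \<open>pt s\<close>.\<close>

lemma partner_unique:
  assumes c: "coherent n" "s \<in> layer n" "t \<in> layer n" "u \<in> layer n"
    and x: "fresh s x"
    and h: "horiz s t" "horiz s u" "tri (pt s) (pt t) x" "tri (pt s) (pt u) x"
  shows "t = u"
proof (rule ccontr)
  assume "t \<noteq> u"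
  then have ne: "pt t \<noteq> pt u" using horiz_unique[OF c h(1,2)] by blast
  obtain r where r: "r \<in> preds s" "r \<in> preds t" "tri (pt r) (pt s) (pt t)"
    using h(1) by (auto simp: horiz_def)
  obtain q where q: "q \<in> preds s" "q \<in> preds u" "tri (pt q) (pt s) (pt u)"
    using h(2) by (auto simp: horiz_def)
  have xn: "x \<noteq> pt r" "x \<noteq> pt q"
    using fresh_not_pred[OF x] r q by blast+
  show False
  proof (cases "r = q")
    case True
    show False
      by (rule no_4_cycle[of "pt s" x "pt t" "pt r" "pt u"])
        (use ne xn r q h True in \<open>auto simp: tri_swap\<close>)
  next
    case False
    then have "tri (pt s) (pt r) (pt q)" using preds_edge[OF c(1,2) r(1) q(1)] by blast
    \<comment> \<open>Of the five diagonals of the 5-cycle, freshness separates two,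
      \<open>ne\<close> one, and this step the last two.\<close>
    moreover have "pt t \<noteq> pt q" "pt r \<noteq> pt u"
      using horiz_pt_not_preds[OF c(1,2,3) h(1) q(1)] horiz_pt_not_preds[OF c(1,2,4) h(2) r(1)]
      by auto
    ultimately show False
      using no_5_cycle[of "pt s" x "pt t" "pt r" "pt q" "pt u"] ne xn r(3) q(3) h(3,4)
      by (auto simp: tri_swap)
  qed
qed

text \<open>A predecessor of \<open>t\<close> in a simplex with \<open>pt t\<close> and
  \<open>x\<close> would close up, through \<open>pt s\<close> and the common predecessor, a cycle
  of length 3 or 4 in the link of \<open>pt t\<close>.\<close>

lemma partner_fresh:
  assumes c: "coherent n" "s \<in> layer n" "t \<in> layer n"
    and x: "fresh s x" and h: "horiz s t" "tri (pt s) (pt t) x"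
  shows "fresh t x"
proof -
  obtain r where r: "r \<in> preds s" "r \<in> preds t" "tri (pt r) (pt s) (pt t)"
    using h(1) by (auto simp: horiz_def)
  have "{pt t, pt q, x} \<notin> K" if q: "q \<in> preds t" for q
  proof
    assume K: "{pt t, pt q, x} \<in> K"
    have sx: "x \<noteq> pt r" using fresh_not_pred[OF x] r by blast
    have sq: "pt s \<noteq> pt q"
      using horiz_pt_not_preds[OF c(1,3,2) horiz_sym[OF h(1)] q] .
    have rq: "tri (pt t) (pt r) (pt q)" if "r \<noteq> q"
      using preds_edge(2)[OF c(1,3) r(2) q that] .
    have tq: "pt t \<noteq> pt q" using rq r(3) by (cases "r = q") (auto simp: tri_def)
    show False
    proof (cases "x = pt q")
      case True
      then have "r \<noteq> q" using sx by blast
      then show False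
        using no_3_cycle[of "pt t" "pt s" "pt r" "pt q"] rq r h True
          by (simp add: tri_swap)
    next
      case False
      then have t: "tri (pt t) (pt q) x" using K tq h by (auto simp: tri_def)
      show False
      proof (cases "r = q")
        case True
        then show False
          using no_3_cycle[of "pt t" "pt s" "pt r" x] t r h
          by (simp add: tri_swap)
      next
        case False
        show False
          by (rule no_4_cycle[of "pt t" x "pt q" "pt r" "pt s"])
            (use t rq[OF False] r h sx sq in \<open>auto simp: tri_swap\<close>)
      qed
    qed
  qed
  moreover have "{pt t, x} \<in> K" "x \<noteq> pt t"
    using tri_edge[of "pt t" x "pt s"] h(2) by (auto simp: tri_swap tri_def)
  ultimately show ?thesis by (simp add: fresh_def)
qed

text \<open>By \<open>partner_unique\<close> a cluster is a single state or a pair, and in a pair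
  each state is the only partner of the other.\<close>

lemma cluster_eq:
  assumes c: "coherent n" "s \<in> layer n" and x: "fresh s x" and t: "t \<in> cluster (layer n) s x"
  shows "t \<in> layer n" "fresh t x" "cluster (layer n) t x = cluster (layer n) s x"
proof -
  have "t \<in> layer n \<and> fresh t x \<and> cluster (layer n) t x = cluster (layer n) s x"
  proof (cases "t = s")
    case False
    then have t: "t \<in> layer n" "horiz s t" "tri (pt s) (pt t) x"
      using t by (auto simp: cluster_def)
    have f: "fresh t x" by (rule partner_fresh[OF c t(1) x t(2,3)])
    have "cluster (layer n) s x = {s, t}"
      using partner_unique[OF c _ _ x] t by (auto simp: cluster_def)
    moreover have "cluster (layer n) t x = {s, t}"
    proof -
      have h: "horiz t s" "tri (pt t) (pt s) x"
        using t horiz_sym by (simp_all add: tri_swap)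
      then have "u = s" if "u \<in> layer n" "horiz t u" "tri (pt t) (pt u) x" for u
        using partner_unique[OF c(1) t(1) that(1) c(2) f] that by blast
      then show ?thesis using h c(2) unfolding cluster_def by blast
    qed
    ultimately show ?thesis using t f by simp
  qed (use c x in simp)
  then show "t \<in> layer n" "fresh t x" "cluster (layer n) t x = cluster (layer n) s x" by blast+
qed

lemma finite_cluster:
  assumes c: "coherent n" "s \<in> layer n" and x: "fresh s x"
  shows "finite (cluster (layer n) s x)"
proof -
  have "\<exists>u. {t \<in> layer n. horiz s t \<and> tri (pt s) (pt t) x} \<subseteq> {u}"
    using partner_unique[OF c _ _ x] by blast
  then have "finite {t \<in> layer n. horiz s t \<and> tri (pt s) (pt t) x}"
    using finite_subset by blast
  then show ?thesis by (simp add: cluster_def)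
qed

text \<open>A state is built from one member of its predecessor set; by \<open>cluster_eq\<close>
  any other member produces the same set.\<close>

lemma coherent: "coherent n"
proof (induction n)
  case 0
  then show ?case by (simp add: coherent_def)
next
  case (Suc n)
  show ?case
    unfolding coherent_def
  proof (intro ballI)
    fix s p assume "s \<in> layer (Suc n)" and p: "p \<in> preds s"
    then obtain s0 where s0: "s0 \<in> layer n" "fresh s0 (pt s)" "preds s = cluster (layer n) s0 (pt s)"
      by auto
    then show "\<exists>m. Suc n = Suc m \<and> p \<in> layer m \<and> fresh p (pt s) \<and>
        preds s = cluster (layer m) p (pt s)"
      using cluster_eq[OF Suc s0(1,2), of p] p by simp
  qed
qed

lemma preds_layer:
  assumes "s \<in> layer (Suc n)" "p \<in> preds s"
  shows "p \<in> layer n" "fresh p (pt s)" "preds s = cluster (layer n) p (pt s)"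
  using coherent[of "Suc n"] assms unfolding coherent_def by blast+

lemma preds_pred_layer:
  assumes "s \<in> layer n" "p \<in> preds s" obtains m where "n = Suc m" "p \<in> layer m"
  using coherent[of n] assms unfolding coherent_def by blast

lemma preds_nonempty: "s \<in> layer (Suc n) \<Longrightarrow> preds s \<noteq> {}"
  by (auto simp: cluster_def)

lemma preds_0: "s \<in> layer 0 \<Longrightarrow> preds s = {}"
  by simp

text \<open>Passing to a predecessor lowers both indices by one, and only the root has no
  predecessor.\<close>

lemma layer_unique: "s \<in> layer n \<Longrightarrow> s \<in> layer m \<Longrightarrow> n = m"
proof (induction n arbitrary: s m)
  case 0
  then have "preds s = {}" by simp
  then have "s \<notin> layer (Suc k)" for k using preds_nonempty by blast
  then show ?case using 0(2) by (metis not0_implies_Suc)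
next
  case (Suc n)
  then obtain p where p: "p \<in> preds s" using preds_nonempty by blast
  then have "m \<noteq> 0" using Suc.prems(2) preds_0 by (metis empty_iff)
  then obtain k where k: "m = Suc k" using not0_implies_Suc by blast
  have "p \<in> layer n" "p \<in> layer k"
    using preds_layer(1)[OF _ p] Suc.prems k by blast+
  then show ?case using Suc.IH k by blast
qed

lemma pt_vertex: "s \<in> layer n \<Longrightarrow> {pt s} \<in> K"
proof (cases n)
  case (Suc m)
  assume "s \<in> layer n"
  then obtain p where "p \<in> layer m" "fresh p (pt s)" using Suc by auto
  then have "{pt p, pt s} \<in> K" by (simp add: fresh_def)
  then show ?thesis by (rule face) auto
qed (use base in simp)

section \<open>Unique lifting of edges and triangles\<close>

definition adj :: "'v state \<Rightarrow> 'v state \<Rightarrow> bool" where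
  "adj s t \<longleftrightarrow> (\<exists>n. s \<in> layer n \<and> t \<in> layer n \<and> horiz s t \<or>
     s \<in> layer n \<and> t \<in> layer (Suc n) \<and> s \<in> preds t \<or>
     t \<in> layer n \<and> s \<in> layer (Suc n) \<and> t \<in> preds s)"

lemma adj_sym: "adj s t \<Longrightarrow> adj t s"
  unfolding adj_def using horiz_sym by blast

lemma adj_cases:
  assumes "adj s t" "s \<in> layer n"
  obtains "t \<in> layer n" "horiz s t" | "t \<in> layer (Suc n)" "s \<in> preds t"
    | m where "n = Suc m" "t \<in> layer m" "t \<in> preds s"
proof -
  obtain m where m: "s \<in> layer m \<and> t \<in> layer m \<and> horiz s t \<or>
      s \<in> layer m \<and> t \<in> layer (Suc m) \<and> s \<in> preds t \<or>
      t \<in> layer m \<and> s \<in> layer (Suc m) \<and> t \<in> preds s"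
    using assms(1) unfolding adj_def by blast
  then show ?thesis
    using that layer_unique[OF assms(2)] by (elim disjE conjE) blast+
qed

lemma adj_edge:
  assumes "adj s t" shows "{pt s, pt t} \<in> K" "pt s \<noteq> pt t"
proof -
  have *: "{pt s, pt t} \<in> K \<and> pt s \<noteq> pt t" if "t \<in> layer (Suc n)" "s \<in> preds t" for n s t
    using preds_layer[OF that] by (auto simp: fresh_def)
  have "{pt s, pt t} \<in> K \<and> pt s \<noteq> pt t"
    using assms unfolding adj_def
  proof (elim exE disjE conjE)
    assume "horiz s t"
    then obtain r where "tri (pt s) (pt t) (pt r)" by (auto simp: horiz_def tri_swap)
    then show ?thesis using tri_edge by (auto simp: tri_def)
  next
    fix n assume "t \<in> layer n" "s \<in> layer (Suc n)" "t \<in> preds s"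
    from *[OF this(2,3)] show ?thesis by (auto simp: insert_commute)
  qed (use * in blast)
  then show "{pt s, pt t} \<in> K" "pt s \<noteq> pt t" by auto
qed

text \<open>Either \<open>x\<close> lies under a predecessor, or in a simplex with one, or it is
  fresh. In the second case \<open>x\<close> is first lifted from that predecessor by induction; in
  the third the next layer contains a lift by construction.\<close>

lemma adj_lift_exists:
  assumes "s \<in> layer n" "{pt s, x} \<in> K" "x \<noteq> pt s"
  shows "\<exists>t. adj s t \<and> pt t = x"
  using assms
proof (induction n arbitrary: s x rule: less_induct)
  case (less n)
  consider (p) "x \<in> pt ` preds s"
    | (h) r where "r \<in> preds s" "{pt s, pt r, x} \<in> K" "x \<notin> pt ` preds s"
    | (f) "fresh s x"
    using less.prems by (auto simp: fresh_def)
  then show ?case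
  proof cases
    case p
    then obtain t where t: "t \<in> preds s" "pt t = x" by blast
    then obtain m where "n = Suc m" "t \<in> layer m" using preds_pred_layer[OF less.prems(1)] by blast
    then have "adj s t" using less.prems(1) t(1) unfolding adj_def by blast
    then show ?thesis using t(2) by blast
  next
    case h
    then obtain m where m: "n = Suc m" using preds_pred_layer[OF less.prems(1)] by blast
    note s = less.prems(1)[unfolded m]
    note r = preds_layer[OF s h(1)]
    have "pt s \<noteq> pt r" using r by (auto simp: fresh_def)
    then have tri: "tri (pt r) (pt s) x" using h less.prems by (auto simp: tri_def insert_commute)
    then have "{pt r, x} \<in> K" "x \<noteq> pt r"
      using tri_edge[of "pt r" x "pt s"] by (auto simp: tri_swap tri_def)
    then obtain t where t: "adj r t" "pt t = x" using less.IH m r(1) by blast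
    \<comment> \<open>Seen from \<open>r\<close>, the lift \<open>t\<close> cannot lie beside, as it
      would then belong to the cluster \<open>preds s\<close>, nor below, as \<open>pt s\<close> is
      fresh at \<open>r\<close>. Hence it lies above \<open>r\<close> and is horizontal to
      \<open>s\<close>.\<close>
    from t(1) r(1) show ?thesis
    proof (cases rule: adj_cases)
      case 1
      then have "t \<in> preds s" using r(3) tri t by (auto simp: cluster_def tri_swap)
      then show ?thesis using h(3) t(2) by blast
    next
      case 2
      then have "horiz s t" using h(1) tri t(2) by (auto simp: horiz_def)
      then show ?thesis using s 2 t(2) unfolding adj_def by blast
    next
      case 3
      then show ?thesis using r(2) tri t(2) by (auto simp: fresh_def tri_def insert_commute)
    qed
  next
    case f
    let ?c = "cluster (layer n) s x"
    have F: "fset (Abs_fset ?c) = ?c"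
      using finite_cluster[OF coherent less.prems(1) f] by (simp add: Abs_fset_inverse)
    then have "State x (Abs_fset ?c) \<in> layer (Suc n)" using less.prems(1) f by auto
    moreover have "s \<in> preds (State x (Abs_fset ?c))" using F by (simp add: cluster_def)
    ultimately have "adj s (State x (Abs_fset ?c))"
      unfolding adj_def using less.prems(1) by blast
    then show ?thesis by (metis state.sel(1))
  qed
qed

text \<open>Neighbours of \<open>s\<close> in different layers lie over different vertices, by
  freshness and \<open>horiz_pt_not_preds\<close>. Within one layer \<open>horiz_unique\<close>,
  \<open>layer_ext\<close> and \<open>preds_edge\<close> apply.\<close>

lemma adj_lift_unique:
  assumes st: "adj s t" and su: "adj s u" and eq: "pt t = pt u"
  shows "t = u"
proof -
  \<comment> \<open>In the names, \<open>p\<close>, \<open>h\<close> and \<open>f\<close> mark a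
    neighbour below, beside and above \<open>s\<close>.\<close>
  have ph: False if "m = Suc k" "s \<in> layer m" "t \<in> layer k" "t \<in> preds s"
    "u \<in> layer m" "horiz s u" "pt t = pt u" for m k t u
    using horiz_pt_not_preds[OF coherent that(2,5,6,4)] that by simp
  have pf: False if "t \<in> preds s" "u \<in> layer (Suc m)" "s \<in> preds u" "pt t = pt u" for m t u
  proof -
    have "{pt s, pt u} \<in> K" "{pt s, pt t, pt u} \<notin> K"
      using preds_layer(2)[OF that(2,3)] that(1) unfolding fresh_def by blast+
    then show False using that(4) by simp
  qed
  have hf: False if "horiz s t" "u \<in> layer (Suc m)" "s \<in> preds u" "pt t = pt u" for m t u
    using preds_layer(2)[OF that(2,3)] horiz_not_fresh[OF that(1)] that(4) by simp
  obtain n where n: "s \<in> layer n" using st unfolding adj_def by blast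
  from st n show ?thesis
  proof (cases rule: adj_cases)
    case t: 1
    from su n show ?thesis
    proof (cases rule: adj_cases)
      case 1
      then show ?thesis using horiz_unique[OF coherent n] t eq by blast
    next
      case 2
      then show ?thesis using hf[OF t(2) _ _ eq] by blast
    next
      case 3
      then show ?thesis using ph[OF 3(1) n 3(2,3) t eq[symmetric]] by blast
    qed
  next
    case t: 2
    from su n show ?thesis
    proof (cases rule: adj_cases)
      case 1
      then show ?thesis using hf[OF _ t eq[symmetric]] by blast
    next
      case 2
      then show ?thesis using layer_ext[OF coherent t(1) 2(1) t(2) 2(2) eq] by blast
    next
      case 3
      then show ?thesis using pf[OF _ t eq[symmetric]] by blast
    qed
  next
    case t: (3 m)
    from su n show ?thesis
    proof (cases rule: adj_cases)
      case 1
      then show ?thesis using ph[OF t(1) n t(2,3) 1 eq] by blast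
    next
      case 2
      then show ?thesis using pf[OF t(3) 2 eq] by blast
    next
      case 3
      then show ?thesis using preds_edge(2)[OF coherent n t(3) 3(3)] eq unfolding tri_def by blast
    qed
  qed
qed

text \<open>Two states above \<open>s\<close> share the predecessor \<open>s\<close>, and two below
  lie in one cluster. Mixed positions reduce to a cluster or a common predecessor, or contradict
  freshness.\<close>

lemma adj_triangle:
  assumes st: "adj s t" and su: "adj s u" and tri: "tri (pt s) (pt t) (pt u)"
  shows "adj t u"
proof -
  have ph: "adj t u" if "m = Suc k" "s \<in> layer m" "t \<in> layer k" "t \<in> preds s"
    "u \<in> layer m" "horiz s u" "tri (pt s) (pt t) (pt u)" for m k t u
  proof -
    note hyps = that
    obtain r where r: "r \<in> preds s" "r \<in> preds u" "tri (pt r) (pt s) (pt u)"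
      using hyps(6) by (auto simp: horiz_def)
    have "r = t"
    proof (rule ccontr)
      assume "r \<noteq> t"
      then have "tri (pt s) (pt r) (pt t)" using preds_edge[OF coherent hyps(2) r(1) hyps(4)] by blast
      then show False
        using no_3_cycle[of "pt s" "pt r" "pt t" "pt u"] r hyps(7)
          by (simp add: tri_swap)
    qed
    then show ?thesis using hyps(1,3,5) r unfolding adj_def by blast
  qed
  have pf: False if "t \<in> preds s" "u \<in> layer (Suc m)" "s \<in> preds u"
    "tri (pt s) (pt t) (pt u)" for m t u
    using preds_layer(2)[OF that(2,3)] that by (auto simp: fresh_def tri_def)
  have hf: "adj t u" if "s \<in> layer m" "t \<in> layer m" "horiz s t" "u \<in> layer (Suc m)" "s \<in> preds u"
    "tri (pt s) (pt t) (pt u)" for m t u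
  proof -
    have "t \<in> preds u" using preds_layer(3)[OF that(4,5)] that by (auto simp: cluster_def)
    then show ?thesis using that unfolding adj_def by blast
  qed
  have tri': "tri (pt s) (pt u) (pt t)" using tri tri_swap by blast
  obtain n where n: "s \<in> layer n" using st unfolding adj_def by blast
  from st n show ?thesis
  proof (cases rule: adj_cases)
    case t: 1
    from su n show ?thesis
    proof (cases rule: adj_cases)
      case u: 1
      obtain r where r: "r \<in> preds s" "r \<in> preds t" "tri (pt r) (pt s) (pt t)"
        using t by (auto simp: horiz_def)
      obtain q where q: "q \<in> preds s" "q \<in> preds u" "tri (pt q) (pt s) (pt u)"
        using u by (auto simp: horiz_def)
      \<comment> \<open>Two horizontal neighbours never span a triangle with \<open>s\<close>: the
        common predecessors would complete a 3-cycle or a 4-cycle in the link of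
        \<open>pt s\<close>.\<close>
      have False
      proof (cases "r = q")
        case True
        then show False
          using no_3_cycle[of "pt s" "pt r" "pt t" "pt u"] r q tri
          by (simp add: tri_swap)
      next
        case False
        then have rq: "tri (pt s) (pt r) (pt q)" using preds_edge[OF coherent n] r q by blast
        have "pt t \<noteq> pt q" "pt u \<noteq> pt r"
          using horiz_pt_not_preds[OF coherent n] t u r q by blast+
        then show False
          using no_4_cycle[of "pt s" "pt t" "pt r" "pt q" "pt u"] rq r(3) q(3) tri
          by (auto simp: tri_swap)
      qed
      then show ?thesis ..
    next
      case 2
      then show ?thesis using hf[OF n t _ _ tri] by blast
    next
      case 3
      then show ?thesis using ph[OF 3(1) n 3(2,3) t tri'] adj_sym by blast
    qed
  next
    case t: 2
    from su n show ?thesis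
    proof (cases rule: adj_cases)
      case 1
      then show ?thesis using hf[OF n 1 t tri'] adj_sym by blast
    next
      case 2
      then have "horiz t u" using t tri by (auto simp: horiz_def)
      then show ?thesis using t 2 unfolding adj_def by blast
    next
      case 3
      then show ?thesis using pf[OF 3(3) t tri'] by blast
    qed
  next
    case t: (3 m)
    from su n show ?thesis
    proof (cases rule: adj_cases)
      case 1
      then show ?thesis using ph[OF t(1) n t(2,3) 1 tri] by blast
    next
      case 2
      then show ?thesis using pf[OF t(3) 2 tri] by blast
    next
      case (3 k)
      then have "t \<noteq> u" using tri by (auto simp: tri_def)
      then have "horiz t u" using preds_edge[OF coherent n] t 3 by blast
      then show ?thesis using t 3 unfolding adj_def by blast
    qed
  qed
qed

section \<open>Injectivity of the projection and distances to the base point\<close>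

abbreviation G :: "'v ugraph" where "G \<equiv> one_skeleton K"

lemma G_simps: "v \<in> verts G \<longleftrightarrow> {v} \<in> K" "{u, v} \<in> edges G \<longleftrightarrow> {u, v} \<in> K \<and> u \<noteq> v"
  by (auto simp: one_skeleton_def card_insert_if)

definition states :: "'v state set" where
  "states = (\<Union>n. layer n)"

lemma adj_states: "adj s t \<Longrightarrow> s \<in> states \<and> t \<in> states"
  unfolding adj_def states_def by blast

lemma covering: "simplicial_covering K states (\<lambda>s t. s = t \<or> adj s t) pt"
proof
  show "abstract_simplicial_complex K" by (rule complex)
next
  fix s x assume s: "s \<in> states" "{pt s, x} \<in> K"
  show "\<exists>t\<in>states. (s = t \<or> adj s t) \<and> pt t = x"
  proof (cases "x = pt s")
    case False
    then obtain t where "adj s t" "pt t = x"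
      using adj_lift_exists s unfolding states_def by blast
    then show ?thesis using adj_states by blast
  qed (use s in blast)
next
  fix s t u assume "s = t \<or> adj s t" "s = u \<or> adj s u" "pt t = pt u"
  then show "t = u" using adj_lift_unique[of s t u] adj_edge(2)[of s t] adj_edge(2)[of s u] by auto
next
  fix s t u assume st: "s = t \<or> adj s t" and su: "s = u \<or> adj s u" and K: "{pt s, pt t, pt u} \<in> K"
  show "t = u \<or> adj t u"
  proof (cases "s = t \<or> s = u \<or> pt t = pt u")
    case True
    then show ?thesis using st su adj_sym adj_lift_unique by blast
  next
    case False
    then have "tri (pt s) (pt t) (pt u)"
      using st su K adj_edge(2)[of s t] adj_edge(2)[of s u] by (simp add: tri_def)
    then show ?thesis using adj_triangle False st su by blast
  qed
qed simp

lemma adj_root: "s \<in> layer n \<Longrightarrow> adj\<^sup>*\<^sup>* s (State b {||})"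
proof (induction n arbitrary: s)
  case (Suc n)
  obtain p where p: "p \<in> preds s" using preds_nonempty[OF Suc.prems] by blast
  have "p \<in> layer n" by (rule preds_layer(1)[OF Suc.prems p])
  then have "adj s p" "adj\<^sup>*\<^sup>* p (State b {||})"
    using Suc p unfolding adj_def by blast+
  then show ?case by (rule converse_rtranclp_into_rtranclp)
qed simp

text \<open>A walk through the root joins the two states and projects to a closed walk; by simple
  connectivity the lifted walk is closed as well.\<close>

lemma pt_inj:
  assumes s: "s \<in> states" and t: "t \<in> states" and eq: "pt s = pt t"
  shows "s = t"
proof -
  have "adj\<^sup>*\<^sup>* s (State b {||})" "adj\<^sup>*\<^sup>* (State b {||}) t"
    using s t adj_root symp_rtranclp[of adj] adj_sym unfolding states_def symp_def by blast+
  then have "adj\<^sup>*\<^sup>* s t" by (rule rtranclp_trans)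
  then obtain n f where f: "f 0 = s" "f n = t" "\<And>i. i < n \<Longrightarrow> adj (f i) (f (Suc i))"
    unfolding rtranclp_power relpowp_fun_conv by blast
  show ?thesis
  proof (cases "n = 0")
    case False
    have "f i \<in> states" if "i \<le> n" for i
      using f(3)[of i] adj_states f(2) t that by (cases "i = n") auto
    then have "f n = f 0"
      by (intro simplicial_covering.closed_walk_lift[OF covering])
        (use f eq False adj_edge systolic in \<open>auto simp: systolic_2_complex_def\<close>)
    then show ?thesis using f by simp
  qed (use f in simp)
qed

lemma vertex_state:
  assumes "{v} \<in> K" obtains s n where "s \<in> layer n" "pt s = v"
proof -
  have "v \<in> pt ` states"
  proof (rule connected_vertices[OF complex _ base _ assms])
    show "path_connected_space (geometric_realization K)"
      using systolic by (simp add: systolic_2_complex_def simply_connected_space_def)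
    have "State b {||} \<in> states" unfolding states_def by (intro UN_I[of 0]) auto
    then show "b \<in> pt ` states" by force
  next
    fix x y assume "x \<in> pt ` states" "{x, y} \<in> K"
    then show "y \<in> pt ` states"
      using simplicial_covering.lift_exists[OF covering] by blast
  qed
  then show ?thesis using that unfolding states_def by blast
qed

lemma reach_base: "s \<in> layer n \<Longrightarrow> reach G n (pt s) b"
proof (induction n arbitrary: s)
  case (Suc n)
  obtain p where p: "p \<in> preds s" using preds_nonempty[OF Suc.prems] by blast
  have "p \<in> layer n" "fresh p (pt s)" using preds_layer[OF Suc.prems p] by blast+
  then show ?case
    using Suc.IH pt_vertex[OF Suc.prems] by (auto simp: reach_Suc G_simps fresh_def insert_commute)
qed (use base in \<open>simp add: G_simps\<close>)

text \<open>Lifting the walk from \<open>s\<close> changes the layer by at most one at each edge.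
  The lift ends over \<open>b\<close>, hence at the root by \<open>pt_inj\<close>.\<close>

lemma layer_le_reach: "reach G k (pt s) b \<Longrightarrow> s \<in> layer n \<Longrightarrow> n \<le> k"
proof (induction k arbitrary: s n)
  case 0
  have "State b {||} \<in> layer 0" by simp
  moreover have "s = State b {||}"
    by (rule pt_inj) (use 0 calculation in \<open>auto simp: states_def simp del: layer.simps\<close>)
  ultimately show ?case using layer_unique 0(2) by blast
next
  case (Suc k)
  then obtain w where w: "{pt s, w} \<in> K" "w \<noteq> pt s" "reach G k w b"
    by (auto simp: reach_Suc G_simps)
  obtain t where t: "adj s t" "pt t = w" using adj_lift_exists[OF Suc.prems(2) w(1,2)] by blast
  from t(1) Suc.prems(2) obtain m where "t \<in> layer m" "n \<le> Suc m"
    by (cases rule: adj_cases) (auto simp del: layer.simps)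
  then show ?case using Suc.IH[of t m] w(3) t(2) by simp
qed

lemma base_distance:
  assumes "s \<in> layer n" shows "path_metric G (pt s) b = real n"
proof -
  obtain m where "reach G m (pt s) b" "path_metric G (pt s) b = real m"
    using path_metric_attained[OF reach_base[OF assms]] .
  then show ?thesis
    using layer_le_reach[OF _ assms] path_metric_le[OF reach_base[OF assms]] by fastforce
qed

text \<open>The edge lifts to adjacent states; equal distances put them in one layer, so they are
  horizontal, and a common predecessor projects to \<open>w\<close>.\<close>

lemma triangle_condition:
  assumes "{u, v} \<in> K" "u \<noteq> v" "path_metric G u b = path_metric G v b"
  obtains w where "{u, w} \<in> K" "{w, v} \<in> K" "path_metric G w b = path_metric G u b - 1"
proof -
  have "{u} \<in> K" using face[OF assms(1)] by simp
  then obtain s n where s: "s \<in> layer n" "pt s = u" by (rule vertex_state)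
  obtain t where t: "adj s t" "pt t = v" using adj_lift_exists[OF s(1), of v] s(2) assms(1,2) by auto
  have level: "t \<in> layer m \<Longrightarrow> m = n" for m
    using base_distance[OF s(1)] base_distance[of t m] s(2) t(2) assms(3) by simp
  from t(1) s(1) show ?thesis
  proof (cases rule: adj_cases)
    case 1
    then obtain r where r: "r \<in> preds s" "tri (pt r) (pt s) (pt t)" by (auto simp: horiz_def)
    obtain m where m: "n = Suc m" "r \<in> layer m" by (rule preds_pred_layer[OF s(1) r(1)])
    show ?thesis
    proof (rule that)
      show "{u, pt r} \<in> K" "{pt r, v} \<in> K"
        using r(2) s(2) t(2) tri_edge[of "pt s" "pt r" "pt t"] tri_edge[of "pt r" "pt t" "pt s"]
        by (simp_all add: tri_swap)
      show "path_metric G (pt r) b = path_metric G u b - 1"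
        using base_distance[OF m(2)] base_distance[OF s(1)] s(2) m(1) by simp
    qed
  next
    case 2
    then show ?thesis using level by fastforce
  next
    case (3 m)
    then show ?thesis using level by fastforce
  qed
qed

section \<open>Comparison of the two path metrics\<close>

lemma squaring_edge:
  "{u, v} \<in> edges (squaring_graph K b) \<longleftrightarrow>
    {u, v} \<in> edges G \<and> path_metric G u b \<noteq> path_metric G v b"
  unfolding squaring_graph_def by (auto simp: doubleton_eq_iff insert_commute)

lemma quasi_isometric_squaring:
  "quasi_isometric (verts G) (path_metric G)
    (verts (squaring_graph K b)) (path_metric (squaring_graph K b))"
proof (rule quasi_isometric_path_metrics)
  let ?H = "squaring_graph K b"
  show verts: "verts ?H = verts G" by (simp add: squaring_graph_def)
  show "edges ?H \<subseteq> edges G" by (auto simp: squaring_graph_def)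
  have base_reach: "\<exists>n. reach G n u b" if "u \<in> verts G" for u
  proof -
    have "{u} \<in> K" using that by (simp add: G_simps)
    then obtain s n where s: "s \<in> layer n" "pt s = u" by (rule vertex_state)
    show ?thesis using reach_base[OF s(1)] s(2) by blast
  qed
  show "\<exists>n. reach G n u v" if uv: "u \<in> verts G" "v \<in> verts G" for u v
  proof -
    obtain n m where "reach G n u b" "reach G m v b"
      using base_reach[OF uv(1)] base_reach[OF uv(2)] by blast
    from reach_trans[OF this(1) reach_sym[OF this(2)]] show ?thesis by blast
  qed
  show "\<exists>m\<le>2. reach ?H m u v" if u: "u \<in> verts G" and uv: "{u, v} \<in> edges G" for u v
  proof -
    have v: "v \<in> verts G"
      using uv simplicial_graph_one_skeleton[OF complex] by (auto simp: simplicial_graph_def)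
    show ?thesis
    proof (cases "path_metric G u b = path_metric G v b")
      case False
      then have "reach ?H 1 u v" using u v uv verts by (simp add: reach_Suc squaring_edge)
      then show ?thesis by (intro exI[of _ 1]) simp
    next
      case True
      obtain w where w: "{u, w} \<in> K" "{w, v} \<in> K" "path_metric G w b = path_metric G u b - 1"
        using triangle_condition[of u v] True uv unfolding G_simps by blast
      \<comment> \<open>The distance of \<open>w\<close> is one less than that of \<open>u\<close>
        and \<open>v\<close>, so both edges survive the deletion.\<close>
      have "{u, w} \<in> edges ?H" "{w, v} \<in> edges ?H"
        unfolding squaring_edge G_simps using w True by auto
      moreover have "w \<in> verts G" using face[OF w(1)] by (simp add: G_simps)
      ultimately have "reach ?H (Suc (Suc 0)) u v" using u v verts by (auto simp: reach_Suc)
      then show ?thesis by (intro exI[of _ "Suc (Suc 0)"]) simp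
    qed
  qed
qed

end

theorem theorem3p1:
  fixes Y :: "'v set set" and b :: 'v
  assumes "systolic_2_complex Y"
    and "b \<in> verts (one_skeleton Y)"
  shows "quasi_isometric
           (verts (one_skeleton Y)) (path_metric (one_skeleton Y))
           (verts (square_skeleton (squaring Y b))) (path_metric (square_skeleton (squaring Y b)))"
proof -
  interpret based_systolic Y b
    by unfold_locales (use assms in \<open>simp_all add: one_skeleton_def\<close>)
  show ?thesis using quasi_isometric_squaring by (simp add: squaring_def)
qed

end
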